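(* Let $\Pi$ be a $k$-party protocol, let $\Pi_{\mathsf S}$ (respectively $\Pi_{\mathsf A}$, $\Pi_{\mathsf{WA}}$) be the annotated protocol modelling secrecy (respectively aliveness, weak agreement), and let $\widetilde\Pi_{\mathsf S}$ (respectively $\widetilde\Pi_{\mathsf A}$, $\widetilde\Pi_{\mathsf{WA}}$) be the corresponding transformed protocol. Let $T_0$ be a set of ground atoms such that $\mathsf{lgKeys}(\Pi)\cap\mathsf{plaintext}(\Pi)\subseteq T_0\cup\mathcal K_\epsilon$, and let $\overline{\phi_{\mathsf S}}$ (respectively $\overline{\phi_{\mathsf A}}$, $\overline{\phi_{\mathsf{WA}}}$) be an attack formula against secrecy (respectively aliveness, weak agreement). For each $\mathsf X\in\{\mathsf S,\mathsf A,\mathsf{WA}\}$: if there is an execution trace $\mathsf{exec}'$ of $\widetilde\Pi_{\mathsf X}$, valid w.r.t. $T_0$, with $\langle\mathsf{exec}',T_0\rangle\models\overline{\phi_{\mathsf X}}$, then there is an execution trace $\mathsf{exec}$ of $\widetilde\Pi_{\mathsf X}$, valid w.r.t. $T_0$, such that $\langle\mathsf{exec},T_0\rangle\models\overline{\phi_{\mathsf X}}$, every session involved in $\mathsf{exec}$ is honest, and $\mathsf{exec}$ involves at most one session of each role.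
   Context: **Messages.** Fix disjoint infinite sets: agents $\mathcal{A}$ (with a special agent $\epsilon\in\mathcal A$, the attacker), agent variables $\mathcal{X}$, names $\mathcal{N}$ (with an infinite subset $\mathcal{N}_\epsilon$ of names initially known to the attacker), variables $\mathcal{Y}$. Terms: elements of $\mathcal X\cup\mathcal A\cup\mathcal Y\cup\mathcal N$; $\mathsf{pub}(u),\mathsf{priv}(u),\mathsf{shk}(u_1,u_2)$ with $u,u_1,u_2\in\mathcal A\cup\mathcal X$ (with $\mathsf{shk}(u_1,u_2)=\mathsf{shk}(u_2,u_1)$); $\mathsf{h}(t)$; and $\mathsf{f}(t_1,t_2)$ for $\mathsf f\in\{\mathsf{encs},\mathsf{enca},\mathsf{sign},\langle\,\rangle\}$ (symmetric encryption, asymmetric encryption, signature, pairing), with $t,t_1,t_2$ terms. $\langle t_1,\dots,t_n\rangle$ abbreviates $\langle t_1,\langle\dots,\langle t_{n-1},t_n\rangle\dots\rangle\rangle$. Ground means without (agent) variables. $\mathsf{St}(t)$ is the set of syntactic subterms of $t$. $\mathcal K_\epsilon=\{\mathsf{priv}(\epsilon)\}\cup\{\mathsf{shk}(a,\epsilon)\mid a\in\mathcal A\}$. Ground atoms are agents, names, and long-term keys $\mathsf{priv}(a),\mathsf{shk}(a,b)$ with $a,b\in\mathcal A$. For a term $t$, $\mathsf{lgKeys}(t)=\{\mathsf{priv}(u)\mid \mathsf{pub}(u)\in\mathsf{St}(t)\text{ or }\mathsf{priv}(u)\in\mathsf{St}(t)\}\cup\{\mathsf{shk}(u_1,u_2)\mid\mathsf{shk}(u_1,u_2)\in\mathsf{St}(t)\}$.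 $\mathsf{plaintext}(\mathsf h(u))=\mathsf{plaintext}(u)$, $\mathsf{plaintext}(\mathsf f(u,v))=\mathsf{plaintext}(u)$ for $\mathsf f\in\{\mathsf{encs},\mathsf{enca},\mathsf{sign}\}$, $\mathsf{plaintext}(\langle u,v\rangle)=\mathsf{plaintext}(u)\cup\mathsf{plaintext}(v)$, $\mathsf{plaintext}(u)=\{u\}$ otherwise. These notions extend to sets of terms, events, sequences of events, protocols by union over all terms occurring in them. **Deduction.** $T\vdash u$ holds if there is a finite proof tree with root $u$, leaves in $T\cup\mathcal A\cup\mathcal N_\epsilon\cup\mathcal K_\epsilon\cup\{\mathsf{pub}(a)\mid a\in\mathcal A\}$, whose nodes are instances of the rules: composition: from $u,v$ infer $\langle u,v\rangle$, $\mathsf{encs}(u,v)$, $\mathsf{enca}(u,v)$, $\mathsf{sign}(u,v)$; from $u$ infer $\mathsf h(u)$; decomposition: from $\langle u,v\rangle$ infer $u$, and infer $v$; from $\mathsf{encs}(u,v)$ and $v$ infer $u$; from $\mathsf{enca}(u,\mathsf{pub}(v))$ and $\mathsf{priv}(v)$ infer $u$; and, optionally (the result holds both with and without this rule), from $\mathsf{sign}(u,v)$ infer $u$. **Protocols.** An event is $\mathsf{rcv}(m)$ or $\mathsf{snd}(m)$ (communication events; $m$ a term) or a status event $\mathsf P(t_1,\dots,t_n)$ ($\mathsf P$ a predicate symbol of arity $n$, $t_i$ terms). A role is $\lambda x_1\dots\lambda x_k.\nu y_1\dots\nu y_p.\mathsf{seq}$ where $X=\{x_1,\dots,x_k\}\subseteq\mathcal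 X$ (parameters: the $k$ participants), $Y=\{y_1,\dots,y_p\}\subseteq\mathcal Y$ (generated nonces), $\mathsf{seq}=\mathsf e_1;\dots;\mathsf e_\ell$ is a sequence of events with $\mathrm{vars}(\mathsf{seq})\smallsetminus X\subseteq\mathcal Y$, such that for every send or status event $\mathsf e_i$: (1) every $x\in\mathrm{vars}(\mathsf e_i)\smallsetminus(X\cup Y)$ is in $\mathrm{vars}(\mathsf e_j)$ for some receive event $\mathsf e_j$ with $j<i$; (2) every variable $x\in\mathsf{plaintext}(\mathsf e_i)\smallsetminus(X\cup Y)$ is in $\mathsf{plaintext}(\mathsf e_j)$ for some receive event $\mathsf e_j$ with $j<i$. Messages of roles are built from identities and generated nonces: no element of $\mathcal N$ occurs in a role. A $k$-party protocol is a map $\Pi$ from $\{1,\dots,k\}$ to roles (each with $k$ parameters). **Traces.** A scenario for $\Pi$ is a finite sequence $(r_1,\mathsf{sid}_1)\cdots(r_n,\mathsf{sid}_n)$ with $1\le r_i\le k$, $\mathsf{sid}_i\in\mathbb N\smallsetminus\{0\}$ (session identifiers), each pair $(r,\mathsf{sid})$ occurring at most as many times as the number of events of $\Pi(r)$, and $\mathsf{sid}_i=\mathsf{sid}_j\Rightarrow r_i=r_j$. Given a scenario and $\alpha:\mathbb N\to\mathcal A^k$, the symbolic trace is $\mathsf e_1^{\mathsf{sid}_1};\dots;\mathsf e_n^{\mathsf{sid}_n}$ (events annotated by session identifiers), where $\mathsf e_i$ is the $q_i$-th event of $\Pi(r_i)$, $q_i=\#\{j\le i\mid\mathsf{sid}_j=\mathsf{sid}_i\}$,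 to which one applies the substitution $\sigma_{r_i,\mathsf{sid}_i}$ mapping each generated nonce variable $y$ of the role to a fresh name $n_y^{\mathsf{sid}_i}\in\mathcal N\smallsetminus\mathcal N_\epsilon$ (pairwise distinct for distinct $(y,\mathsf{sid})$), the $m$-th parameter to the $m$-th component of $\alpha(\mathsf{sid}_i)$, and every other variable $z$ to a fresh variable $z^{\mathsf{sid}_i}$. An execution trace of $\Pi$ is an instance $\mathsf{tr}\sigma$ of a symbolic trace $\mathsf{tr}$ by a ground substitution $\sigma$ with domain $\mathrm{vars}(\mathsf{tr})$. $\mathsf{exec}_i$ is the prefix of the first $i$ events ($\mathsf{exec}_0=[\,]$). $\mathsf K(\mathsf{exec})=\{u\mid\mathsf{snd}(u)\in\mathsf{exec}\}$. $\mathsf{exec}=\mathsf e_1;\dots;\mathsf e_\ell$ is valid w.r.t. a set $T_0$ of ground terms if $T_0\cup\mathsf K(\mathsf{exec}_i)\vdash m$ whenever $\mathsf e_i=\mathsf{rcv}(m)$. A session $\mathsf{sid}$ with $\alpha(\mathsf{sid})=(a_1,\dots,a_k)$ is dishonest (w.r.t. $\alpha$ and $T_0$) if for some $i$, $T_0\vdash\mathsf{priv}(a_i)$ or $T_0\vdash\mathsf{shk}(a_i,v)$ for some $v\neq\epsilon$; otherwise it is honest. **Logic.** Formulas: $\phi::=\mathsf{learn}(u_0)\mid\neg\phi\mid\exists x.\phi\mid\phi_1\vee\phi_2\mid\mathsf C(u)\mid\Diamond\psi\mid\psi$ and $\psi::=\mathsf{true}\mid\mathsf P(u_1,\dots,u_n)\mid\neg\psi\mid\psi_1\vee\psi_2$,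 with $u_i$ terms, $u\in\mathcal A\cup\mathcal X$; $\wedge$ is defined as usual and $\mathsf{NC}(u)=\neg\mathsf C(u)$. For a ground execution trace: $\langle\mathsf{exec},T_0\rangle\models\mathsf{true}$ always; $\models\mathsf{learn}(m)$ iff $T_0\cup\mathsf K(\mathsf{exec})\vdash m$; $\neg,\vee$ as usual; $\models\exists x.\phi$ iff $\models\phi\{x\mapsto t\}$ for some ground term $t$ (such that $\phi\{x\mapsto t\}$ is again a formula, so an $x$ occurring inside $\mathsf C$ is instantiated by an agent); $\models\mathsf P(t_1,\dots,t_n)$ iff the last event of $\mathsf{exec}$ is $\mathsf P(t_1,\dots,t_n)$; $\models\mathsf C(u)$ iff $T_0\vdash\mathsf{priv}(u)$ or $T_0\vdash\mathsf{shk}(u,v)$ for some $v\ne\epsilon$; $\models\Diamond\psi$ iff $\langle\mathsf{exec}_i,T_0\rangle\models\psi$ for some $0\le i\le\mathrm{length}(\mathsf{exec})$. **Transformation.** For terms $u$ and $\mathsf{tag}$, $[u]_{\mathsf{tag}}$ is defined by $[\langle u_1,u_2\rangle]_{\mathsf{tag}}=\langle[u_1]_{\mathsf{tag}},[u_2]_{\mathsf{tag}}\rangle$; $[\mathsf f(u_1,u_2)]_{\mathsf{tag}}=\mathsf f(\langle\mathsf{tag},[u_1]_{\mathsf{tag}}\rangle,[u_2]_{\mathsf{tag}})$ for $\mathsf f\in\{\mathsf{encs},\mathsf{enca},\mathsf{sign}\}$; $[\mathsf h(u_1)]_{\mathsf{tag}}=\mathsf h(\langle\mathsf{tag},[u_1]_{\mathsf{tag}}\rangle)$;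 $[u]_{\mathsf{tag}}=u$ otherwise; extended to events and sequences of events. If $\Pi(j)=\lambda x_1^j\dots\lambda x_k^j.\nu y_1^j\dots\nu y_{p_j}^j.\mathsf{seq}^j$ and $z_i^j$ ($1\le i,j\le k$) are variables of $\mathcal Y$ not occurring in $\Pi$, then the transformed protocol is $\widetilde\Pi(j)=\lambda x_1^j\dots\lambda x_k^j.\nu y_1^j\dots\nu y_{p_j}^j.\nu z_j^j.\ \mathsf{rcv}(u_1^j);\dots;\mathsf{rcv}(u_{j-1}^j);\mathsf{snd}(u_j^j);\mathsf{rcv}(u_{j+1}^j);\dots;\mathsf{rcv}(u_k^j);[\mathsf{seq}^j]_{\tau_j}$ with $u_i^j=\langle x_i^j,z_i^j\rangle$ and $\tau_j=\langle u_1^j,\dots,u_k^j\rangle$. **Annotated protocols and attack formulas.** Let $\Pi(j)=\lambda x_1^j\dots\lambda x_k^j.\nu y_1^j\dots\nu y_{p_j}^j.\mathsf{seq}^j$ for $1\le j\le k$; the predicates $\mathsf{Secret},\mathsf{Start},\mathsf{End},\mathsf{End}_j$ below do not occur in $\Pi$. - Secrecy (of the nonce $y_h^j$, for fixed $1\le j\le k$, $1\le h\le p_j$): $\Pi_{\mathsf S}$ is $\Pi$ except that in role $j$ the sequence becomes $\mathsf{Secret}(x_1^j,\dots,x_k^j,y_h^j);\mathsf{seq}^j$. $\overline{\phi_{\mathsf S}}=\exists x_1\dots\exists x_k.\exists y.\,[\Diamond\mathsf{Secret}(x_1,\dots,x_k,y)\wedge\mathsf{NC}(x_1)\wedge\dots\wedge\mathsf{NC}(x_k)\wedge\mathsf{learn}(y)]$.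 - Aliveness: in $\Pi_{\mathsf A}$, the sequence of each role $j$ becomes $\mathsf{Start}(x_j^j);\mathsf{seq}^j;\mathsf{End}(x_1^j,\dots,x_k^j)$. $\overline{\phi_{\mathsf A}}=\exists y_1\dots\exists y_k.[\mathsf{End}(y_1,\dots,y_k)\wedge\mathsf{NC}(y_1)\wedge\dots\wedge\mathsf{NC}(y_k)\wedge(\neg\Diamond\mathsf{Start}(y_1)\vee\dots\vee\neg\Diamond\mathsf{Start}(y_k))]$. - Weak agreement: in $\Pi_{\mathsf{WA}}$, the sequence of each role $j$ becomes $\mathsf{Start}(x_j^j,x_1^j);\dots;\mathsf{Start}(x_j^j,x_k^j);\mathsf{seq}^j;\mathsf{End}_j(x_1^j,\dots,x_k^j)$. $\overline{\phi_{\mathsf{WA}}}=\exists y_1\dots\exists y_k.[\mathsf{End}_j(y_1,\dots,y_k)\wedge\mathsf{NC}(y_1)\wedge\dots\wedge\mathsf{NC}(y_k)\wedge\neg\Diamond\mathsf{Start}(y_i,y_j)]$ for some $i,j\in\{1,\dots,k\}$ with $i\ne j$. *)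

theory Defs
  imports "HOL-Library.Uprod" "HOL-Library.Infinite_Typeclass"
begin

section \<open>Messages\<close>

text \<open>
  The type parameters \<open>'a\<close>, \<open>'x\<close>, \<open>'y\<close>, \<open>'n\<close> are the sets of agents, agent variables, variables
  and names. An element of \<open>('a, 'x) agt\<close> is an agent or an agent variable. Unordered pairs make
  the equation \<open>shk(u, v) = shk(v, u)\<close> hold by construction.
\<close>

datatype (agt_agents: 'a, agt_avars: 'x) agt = Agt 'a | AVar 'x

datatype (agents: 'a, avars: 'x, vars: 'y, names: 'n) msg =
    Atm "('a, 'x) agt"
  | Var 'y
  | Name 'n
  | Pub "('a, 'x) agt"
  | Priv "('a, 'x) agt"
  | Shk "('a, 'x) agt uprod"
  | Hash "('a, 'x, 'y, 'n) msg"
  | Encs "('a, 'x, 'y, 'n) msg" "('a, 'x, 'y, 'n) msg"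
  | Enca "('a, 'x, 'y, 'n) msg" "('a, 'x, 'y, 'n) msg"
  | Sign "('a, 'x, 'y, 'n) msg" "('a, 'x, 'y, 'n) msg"
  | Pair "('a, 'x, 'y, 'n) msg" "('a, 'x, 'y, 'n) msg"

fun tuple :: "('a, 'x, 'y, 'n) msg list \<Rightarrow> ('a, 'x, 'y, 'n) msg" where
  "tuple [t] = t"
| "tuple (t # t' # ts) = Pair t (tuple (t' # ts))"

definition ground :: "('a, 'x, 'y, 'n) msg \<Rightarrow> bool" where
  "ground t \<longleftrightarrow> avars t = {} \<and> vars t = {}"

primrec St :: "('a, 'x, 'y, 'n) msg \<Rightarrow> ('a, 'x, 'y, 'n) msg set" where
  "St (Atm u) = {Atm u}"
| "St (Var y) = {Var y}"
| "St (Name n) = {Name n}"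
| "St (Pub u) = {Pub u, Atm u}"
| "St (Priv u) = {Priv u, Atm u}"
| "St (Shk p) = insert (Shk p) (Atm ` set_uprod p)"
| "St (Hash t) = insert (Hash t) (St t)"
| "St (Encs t1 t2) = insert (Encs t1 t2) (St t1 \<union> St t2)"
| "St (Enca t1 t2) = insert (Enca t1 t2) (St t1 \<union> St t2)"
| "St (Sign t1 t2) = insert (Sign t1 t2) (St t1 \<union> St t2)"
| "St (Pair t1 t2) = insert (Pair t1 t2) (St t1 \<union> St t2)"

definition lgKeys :: "('a, 'x, 'y, 'n) msg \<Rightarrow> ('a, 'x, 'y, 'n) msg set" where
  "lgKeys t = {Priv u | u. Pub u \<in> St t \<or> Priv u \<in> St t} \<union> {Shk p | p. Shk p \<in> St t}"

primrec plaintext :: "('a, 'x, 'y, 'n) msg \<Rightarrow> ('a, 'x, 'y, 'n) msg set" where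
  "plaintext (Atm u) = {Atm u}"
| "plaintext (Var y) = {Var y}"
| "plaintext (Name n) = {Name n}"
| "plaintext (Pub u) = {Pub u}"
| "plaintext (Priv u) = {Priv u}"
| "plaintext (Shk p) = {Shk p}"
| "plaintext (Hash t) = plaintext t"
| "plaintext (Encs t1 t2) = plaintext t1"
| "plaintext (Enca t1 t2) = plaintext t1"
| "plaintext (Sign t1 t2) = plaintext t1"
| "plaintext (Pair t1 t2) = plaintext t1 \<union> plaintext t2"

definition ground_atoms :: "('a, 'x, 'y, 'n) msg set" where
  "ground_atoms = range (\<lambda>a. Atm (Agt a)) \<union> range Name \<union> range (\<lambda>a. Priv (Agt a))
     \<union> {Shk (Upair (Agt a) (Agt b)) | a b. True}"

definition eps_keys :: "'a \<Rightarrow> ('a, 'x, 'y, 'n) msg set" where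
  "eps_keys \<epsilon> = insert (Priv (Agt \<epsilon>)) (range (\<lambda>a. Shk (Upair (Agt a) (Agt \<epsilon>))))"

text \<open>
  Simultaneous substitution of agent variables and variables. Below \<open>Pub\<close>, \<open>Priv\<close> and \<open>Shk\<close> only
  an agent or agent variable can be substituted; an ill-sorted replacement leaves the agent
  variable in place there, and every use below rules this situation out. The type of variables may
  change.
\<close>

primrec subst_agt :: "('x \<Rightarrow> ('a, 'x, 'y, 'n) msg) \<Rightarrow> ('a, 'x) agt \<Rightarrow> ('a, 'x) agt" where
  "subst_agt \<theta> (Agt a) = Agt a"
| "subst_agt \<theta> (AVar x) = (case \<theta> x of Atm u \<Rightarrow> u | _ \<Rightarrow> AVar x)"

primrec subst_atm :: "('x \<Rightarrow> ('a, 'x, 'y, 'n) msg) \<Rightarrow> ('a, 'x) agt \<Rightarrow> ('a, 'x, 'y, 'n) msg" where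
  "subst_atm \<theta> (Agt a) = Atm (Agt a)"
| "subst_atm \<theta> (AVar x) = \<theta> x"

primrec subst :: "('x \<Rightarrow> ('a, 'x, 'z, 'n) msg) \<Rightarrow> ('y \<Rightarrow> ('a, 'x, 'z, 'n) msg)
    \<Rightarrow> ('a, 'x, 'y, 'n) msg \<Rightarrow> ('a, 'x, 'z, 'n) msg" where
  "subst \<theta> \<sigma> (Atm u) = subst_atm \<theta> u"
| "subst \<theta> \<sigma> (Var y) = \<sigma> y"
| "subst \<theta> \<sigma> (Name n) = Name n"
| "subst \<theta> \<sigma> (Pub u) = Pub (subst_agt \<theta> u)"
| "subst \<theta> \<sigma> (Priv u) = Priv (subst_agt \<theta> u)"
| "subst \<theta> \<sigma> (Shk p) = Shk (map_uprod (subst_agt \<theta>) p)"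
| "subst \<theta> \<sigma> (Hash t) = Hash (subst \<theta> \<sigma> t)"
| "subst \<theta> \<sigma> (Encs t1 t2) = Encs (subst \<theta> \<sigma> t1) (subst \<theta> \<sigma> t2)"
| "subst \<theta> \<sigma> (Enca t1 t2) = Enca (subst \<theta> \<sigma> t1) (subst \<theta> \<sigma> t2)"
| "subst \<theta> \<sigma> (Sign t1 t2) = Sign (subst \<theta> \<sigma> t1) (subst \<theta> \<sigma> t2)"
| "subst \<theta> \<sigma> (Pair t1 t2) = Pair (subst \<theta> \<sigma> t1) (subst \<theta> \<sigma> t2)"


section \<open>Deduction\<close>

text \<open>
  \<open>sg\<close> tells whether the optional rule opening signatures is present, \<open>\<epsilon>\<close> is the attacker and
  \<open>Ne\<close> is the set of names initially known to the attacker.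
\<close>

inductive deduce :: "bool \<Rightarrow> 'a \<Rightarrow> 'n set \<Rightarrow> ('a, 'x, 'y, 'n) msg set \<Rightarrow> ('a, 'x, 'y, 'n) msg \<Rightarrow> bool"
  for sg :: bool and \<epsilon> :: 'a and Ne :: "'n set" and T :: "('a, 'x, 'y, 'n) msg set" where
  known: "t \<in> T \<Longrightarrow> deduce sg \<epsilon> Ne T t"
| agent: "deduce sg \<epsilon> Ne T (Atm (Agt a))"
| name: "n \<in> Ne \<Longrightarrow> deduce sg \<epsilon> Ne T (Name n)"
| eps_key: "t \<in> eps_keys \<epsilon> \<Longrightarrow> deduce sg \<epsilon> Ne T t"
| pub: "deduce sg \<epsilon> Ne T (Pub (Agt a))"
| pair: "deduce sg \<epsilon> Ne T u \<Longrightarrow> deduce sg \<epsilon> Ne T v \<Longrightarrow> deduce sg \<epsilon> Ne T (Pair u v)"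
| encs: "deduce sg \<epsilon> Ne T u \<Longrightarrow> deduce sg \<epsilon> Ne T v \<Longrightarrow> deduce sg \<epsilon> Ne T (Encs u v)"
| enca: "deduce sg \<epsilon> Ne T u \<Longrightarrow> deduce sg \<epsilon> Ne T v \<Longrightarrow> deduce sg \<epsilon> Ne T (Enca u v)"
| sign: "deduce sg \<epsilon> Ne T u \<Longrightarrow> deduce sg \<epsilon> Ne T v \<Longrightarrow> deduce sg \<epsilon> Ne T (Sign u v)"
| hash: "deduce sg \<epsilon> Ne T u \<Longrightarrow> deduce sg \<epsilon> Ne T (Hash u)"
| fst: "deduce sg \<epsilon> Ne T (Pair u v) \<Longrightarrow> deduce sg \<epsilon> Ne T u"
| snd: "deduce sg \<epsilon> Ne T (Pair u v) \<Longrightarrow> deduce sg \<epsilon> Ne T v"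
| decs: "deduce sg \<epsilon> Ne T (Encs u v) \<Longrightarrow> deduce sg \<epsilon> Ne T v \<Longrightarrow> deduce sg \<epsilon> Ne T u"
| deca: "deduce sg \<epsilon> Ne T (Enca u (Pub w)) \<Longrightarrow> deduce sg \<epsilon> Ne T (Priv w) \<Longrightarrow> deduce sg \<epsilon> Ne T u"
| open_sign: "sg \<Longrightarrow> deduce sg \<epsilon> Ne T (Sign u v) \<Longrightarrow> deduce sg \<epsilon> Ne T u"

definition compromised ::
  "bool \<Rightarrow> 'a \<Rightarrow> 'n set \<Rightarrow> ('a, 'x, 'y, 'n) msg set \<Rightarrow> ('a, 'x) agt \<Rightarrow> bool" where
  "compromised sg \<epsilon> Ne T0 u \<longleftrightarrow>
     deduce sg \<epsilon> Ne T0 (Priv u) \<or> (\<exists>v. v \<noteq> \<epsilon> \<and> deduce sg \<epsilon> Ne T0 (Shk (Upair u (Agt v))))"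


section \<open>Protocols\<close>

text \<open>
  The special predicate symbols are distinct by construction. Symbols are applied to argument
  lists, so that a symbol together with a list length plays the role of a symbol with an arity.
\<close>

datatype 'p pred = Secret | Start | End | EndRole nat | Other 'p

datatype (terms_in: 'm, preds_in: 'p) event = Rcv 'm | Snd 'm | Status 'p "'m list"

type_synonym ('a, 'x, 'y, 'n, 'p) ev = "(('a, 'x, 'y, 'n) msg, 'p pred) event"

fun is_rcv :: "('m, 'p) event \<Rightarrow> bool" where
  "is_rcv (Rcv m) = True"
| "is_rcv _ = False"

definition ev_vars :: "('a, 'x, 'y, 'n, 'p) ev \<Rightarrow> 'y set" where
  "ev_vars e = (\<Union>t\<in>terms_in e. vars t)"

definition ev_plaintext :: "('a, 'x, 'y, 'n, 'p) ev \<Rightarrow> ('a, 'x, 'y, 'n) msg set" where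
  "ev_plaintext e = (\<Union>t\<in>terms_in e. plaintext t)"

datatype ('a, 'x, 'y, 'n, 'p) role =
  Role (params: "'x list") (nonces: "'y list") (events: "('a, 'x, 'y, 'n, 'p) ev list")

definition role_terms :: "('a, 'x, 'y, 'n, 'p) role \<Rightarrow> ('a, 'x, 'y, 'n) msg set" where
  "role_terms R = (\<Union>e\<in>set (events R). terms_in e)"

definition wf_role :: "nat \<Rightarrow> ('a, 'x, 'y, 'n, 'p) role \<Rightarrow> bool" where
  "wf_role k R \<longleftrightarrow>
     length (params R) = k \<and> distinct (params R) \<and> distinct (nonces R) \<and>
     (\<forall>t\<in>role_terms R. avars t \<subseteq> set (params R) \<and> names t = {}) \<and>
     (\<forall>i<length (events R). \<not> is_rcv (events R ! i) \<longrightarrow>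
        (\<forall>y\<in>ev_vars (events R ! i) - set (nonces R).
           \<exists>j<i. is_rcv (events R ! j) \<and> y \<in> ev_vars (events R ! j)) \<and>
        (\<forall>y. Var y \<in> ev_plaintext (events R ! i) \<and> y \<notin> set (nonces R) \<longrightarrow>
           (\<exists>j<i. is_rcv (events R ! j) \<and> Var y \<in> ev_plaintext (events R ! j))))"

text \<open>
  Only the values of a protocol on \<open>{1..k}\<close> matter. Role indices and the indices of parameters and
  nonces are counted from 1 in formulas, list positions from 0.
\<close>

type_synonym ('a, 'x, 'y, 'n, 'p) protocol = "nat \<Rightarrow> ('a, 'x, 'y, 'n, 'p) role"

definition is_protocol :: "nat \<Rightarrow> ('a, 'x, 'y, 'n, 'p) protocol \<Rightarrow> bool" where
  "is_protocol k \<Pi> \<longleftrightarrow> (\<forall>j\<in>{1..k}. wf_role k (\<Pi> j))"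

definition protocol_terms :: "nat \<Rightarrow> ('a, 'x, 'y, 'n, 'p) protocol \<Rightarrow> ('a, 'x, 'y, 'n) msg set" where
  "protocol_terms k \<Pi> = (\<Union>j\<in>{1..k}. role_terms (\<Pi> j))"

definition protocol_nonces :: "nat \<Rightarrow> ('a, 'x, 'y, 'n, 'p) protocol \<Rightarrow> 'y set" where
  "protocol_nonces k \<Pi> = (\<Union>j\<in>{1..k}. set (nonces (\<Pi> j)))"

definition protocol_vars :: "nat \<Rightarrow> ('a, 'x, 'y, 'n, 'p) protocol \<Rightarrow> 'y set" where
  "protocol_vars k \<Pi> = protocol_nonces k \<Pi> \<union> (\<Union>t\<in>protocol_terms k \<Pi>. vars t)"

definition protocol_preds :: "nat \<Rightarrow> ('a, 'x, 'y, 'n, 'p) protocol \<Rightarrow> 'p pred set" where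
  "protocol_preds k \<Pi> = (\<Union>j\<in>{1..k}. \<Union>e\<in>set (events (\<Pi> j)). preds_in e)"

definition protocol_lgKeys :: "nat \<Rightarrow> ('a, 'x, 'y, 'n, 'p) protocol \<Rightarrow> ('a, 'x, 'y, 'n) msg set" where
  "protocol_lgKeys k \<Pi> = (\<Union>t\<in>protocol_terms k \<Pi>. lgKeys t)"

definition protocol_plaintext :: "nat \<Rightarrow> ('a, 'x, 'y, 'n, 'p) protocol \<Rightarrow> ('a, 'x, 'y, 'n) msg set" where
  "protocol_plaintext k \<Pi> = (\<Union>t\<in>protocol_terms k \<Pi>. plaintext t)"


section \<open>Traces\<close>

definition is_scenario :: "nat \<Rightarrow> ('a, 'x, 'y, 'n, 'p) protocol \<Rightarrow> (nat \<times> nat) list \<Rightarrow> bool" where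
  "is_scenario k \<Pi> sc \<longleftrightarrow>
     (\<forall>(r, sid)\<in>set sc. 1 \<le> r \<and> r \<le> k \<and> sid \<noteq> 0 \<and>
        count_list sc (r, sid) \<le> length (events (\<Pi> r))) \<and>
     (\<forall>(r, sid)\<in>set sc. \<forall>(r', sid')\<in>set sc. sid = sid' \<longrightarrow> r = r')"

text \<open>
  \<open>nonce y sid\<close> is the fresh name generated for the nonce variable \<open>y\<close> in session \<open>sid\<close>.
\<close>

definition fresh_nonces ::
  "'n set \<Rightarrow> nat \<Rightarrow> ('a, 'x, 'y, 'n, 'p) protocol \<Rightarrow> ('y \<Rightarrow> nat \<Rightarrow> 'n) \<Rightarrow> bool" where
  "fresh_nonces Ne k \<Pi> nonce \<longleftrightarrow>
     inj_on (\<lambda>(y, sid). nonce y sid) (protocol_nonces k \<Pi> \<times> UNIV) \<and>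
     (\<forall>y\<in>protocol_nonces k \<Pi>. \<forall>sid. nonce y sid \<notin> Ne)"

definition param_subst ::
  "('a, 'x, 'y, 'n, 'p) role \<Rightarrow> 'a list \<Rightarrow> 'x \<Rightarrow> ('a, 'x, 'z, 'n) msg" where
  "param_subst R as x =
     (case map_of (zip (params R) as) x of Some a \<Rightarrow> Atm (Agt a) | None \<Rightarrow> Atm (AVar x))"

text \<open>
  Symbolic traces have variables in \<open>'y \<times> nat\<close>: the pair \<open>(y, sid)\<close> is the fresh variable for \<open>y\<close> in
  session \<open>sid\<close>.
\<close>

definition var_subst ::
  "('y \<Rightarrow> nat \<Rightarrow> 'n) \<Rightarrow> ('a, 'x, 'y, 'n, 'p) role \<Rightarrow> nat \<Rightarrow> 'y \<Rightarrow> ('a, 'x, 'y \<times> nat, 'n) msg" where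
  "var_subst nonce R sid y = (if y \<in> set (nonces R) then Name (nonce y sid) else Var (y, sid))"

definition symbolic_trace ::
  "('y \<Rightarrow> nat \<Rightarrow> 'n) \<Rightarrow> ('a, 'x, 'y, 'n, 'p) protocol \<Rightarrow> (nat \<times> nat) list \<Rightarrow> (nat \<Rightarrow> 'a list)
     \<Rightarrow> (('a, 'x, 'y \<times> nat, 'n, 'p) ev \<times> nat) list" where
  "symbolic_trace nonce \<Pi> sc \<alpha> =
     map (\<lambda>i. let (r, sid) = sc ! i; q = card {j. j \<le> i \<and> snd (sc ! j) = sid} in
            (map_event (subst (param_subst (\<Pi> r) (\<alpha> sid)) (var_subst nonce (\<Pi> r) sid)) id
               (events (\<Pi> r) ! (q - 1)), sid))
         [0..<length sc]"

type_synonym ('a, 'x, 'y, 'n, 'p) trace = "(('a, 'x, 'y, 'n, 'p) ev \<times> nat) list"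

definition is_exec ::
  "('y \<Rightarrow> nat \<Rightarrow> 'n) \<Rightarrow> nat \<Rightarrow> ('a, 'x, 'y, 'n, 'p) protocol \<Rightarrow> (nat \<times> nat) list \<Rightarrow> (nat \<Rightarrow> 'a list)
     \<Rightarrow> ('a, 'x, 'y, 'n, 'p) trace \<Rightarrow> bool" where
  "is_exec nonce k \<Pi> sc \<alpha> exec \<longleftrightarrow>
     is_scenario k \<Pi> sc \<and> (\<forall>sid. length (\<alpha> sid) = k) \<and>
     (\<exists>\<sigma>. (\<forall>(e, sid)\<in>set (symbolic_trace nonce \<Pi> sc \<alpha>). \<forall>v\<in>ev_vars e. ground (\<sigma> v)) \<and>
          exec = map (\<lambda>(e, sid). (map_event (subst (\<lambda>x. Atm (AVar x)) \<sigma>) id e, sid))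
                     (symbolic_trace nonce \<Pi> sc \<alpha>))"

definition K :: "('a, 'x, 'y, 'n, 'p) trace \<Rightarrow> ('a, 'x, 'y, 'n) msg set" where
  "K exec = {u. \<exists>sid. (Snd u, sid) \<in> set exec}"

definition valid ::
  "bool \<Rightarrow> 'a \<Rightarrow> 'n set \<Rightarrow> ('a, 'x, 'y, 'n) msg set \<Rightarrow> ('a, 'x, 'y, 'n, 'p) trace \<Rightarrow> bool" where
  "valid sg \<epsilon> Ne T0 exec \<longleftrightarrow>
     (\<forall>i m. 1 \<le> i \<and> i \<le> length exec \<and> fst (exec ! (i - 1)) = Rcv m \<longrightarrow>
        deduce sg \<epsilon> Ne (T0 \<union> K (take i exec)) m)"

definition honest ::
  "bool \<Rightarrow> 'a \<Rightarrow> 'n set \<Rightarrow> ('a, 'x, 'y, 'n) msg set \<Rightarrow> (nat \<Rightarrow> 'a list) \<Rightarrow> nat \<Rightarrow> bool" where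
  "honest sg \<epsilon> Ne T0 \<alpha> sid \<longleftrightarrow> (\<forall>a\<in>set (\<alpha> sid). \<not> compromised sg \<epsilon> Ne T0 (Agt a))"


section \<open>Logic\<close>

datatype ('a, 'x, 'y, 'n, 'p) sform =
    STrue
  | SPred "'p pred" "('a, 'x, 'y, 'n) msg list"
  | SNot "('a, 'x, 'y, 'n, 'p) sform"
  | SOr "('a, 'x, 'y, 'n, 'p) sform" "('a, 'x, 'y, 'n, 'p) sform"

text \<open>\<open>ExA\<close> quantifies over an agent variable, \<open>ExV\<close> over a variable.\<close>

datatype ('a, 'x, 'y, 'n, 'p) form =
    Learn "('a, 'x, 'y, 'n) msg"
  | Neg "('a, 'x, 'y, 'n, 'p) form"
  | ExA 'x "('a, 'x, 'y, 'n, 'p) form"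
  | ExV 'y "('a, 'x, 'y, 'n, 'p) form"
  | Or "('a, 'x, 'y, 'n, 'p) form" "('a, 'x, 'y, 'n, 'p) form"
  | Comp "('a, 'x) agt"
  | Once "('a, 'x, 'y, 'n, 'p) sform"
  | State "('a, 'x, 'y, 'n, 'p) sform"

abbreviation And ::
  "('a, 'x, 'y, 'n, 'p) form \<Rightarrow> ('a, 'x, 'y, 'n, 'p) form \<Rightarrow> ('a, 'x, 'y, 'n, 'p) form" where
  "And \<phi> \<psi> \<equiv> Neg (Or (Neg \<phi>) (Neg \<psi>))"

abbreviation NC :: "('a, 'x) agt \<Rightarrow> ('a, 'x, 'y, 'n, 'p) form" where
  "NC u \<equiv> Neg (Comp u)"

definition Conj :: "('a, 'x, 'y, 'n, 'p) form list \<Rightarrow> ('a, 'x, 'y, 'n, 'p) form" where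
  "Conj \<phi>s = foldr And \<phi>s (State STrue)"

definition Disj :: "('a, 'x, 'y, 'n, 'p) form list \<Rightarrow> ('a, 'x, 'y, 'n, 'p) form" where
  "Disj \<phi>s = foldr Or \<phi>s (Neg (State STrue))"

primrec subst_sform :: "('x \<Rightarrow> ('a, 'x, 'y, 'n) msg) \<Rightarrow> ('y \<Rightarrow> ('a, 'x, 'y, 'n) msg)
    \<Rightarrow> ('a, 'x, 'y, 'n, 'p) sform \<Rightarrow> ('a, 'x, 'y, 'n, 'p) sform" where
  "subst_sform \<theta> \<sigma> STrue = STrue"
| "subst_sform \<theta> \<sigma> (SPred p ts) = SPred p (map (subst \<theta> \<sigma>) ts)"
| "subst_sform \<theta> \<sigma> (SNot \<psi>) = SNot (subst_sform \<theta> \<sigma> \<psi>)"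
| "subst_sform \<theta> \<sigma> (SOr \<psi>1 \<psi>2) = SOr (subst_sform \<theta> \<sigma> \<psi>1) (subst_sform \<theta> \<sigma> \<psi>2)"

text \<open>
  Bound variables are not renamed: only ground terms are ever substituted, so nothing can be
  captured.
\<close>

primrec subst_form :: "('a, 'x, 'y, 'n, 'p) form \<Rightarrow> ('x \<Rightarrow> ('a, 'x, 'y, 'n) msg)
    \<Rightarrow> ('y \<Rightarrow> ('a, 'x, 'y, 'n) msg) \<Rightarrow> ('a, 'x, 'y, 'n, 'p) form" where
  "subst_form (Learn t) \<theta> \<sigma> = Learn (subst \<theta> \<sigma> t)"
| "subst_form (Neg \<phi>) \<theta> \<sigma> = Neg (subst_form \<phi> \<theta> \<sigma>)"
| "subst_form (ExA x \<phi>) \<theta> \<sigma> = ExA x (subst_form \<phi> (\<theta>(x := Atm (AVar x))) \<sigma>)"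
| "subst_form (ExV y \<phi>) \<theta> \<sigma> = ExV y (subst_form \<phi> \<theta> (\<sigma>(y := Var y)))"
| "subst_form (Or \<phi>1 \<phi>2) \<theta> \<sigma> = Or (subst_form \<phi>1 \<theta> \<sigma>) (subst_form \<phi>2 \<theta> \<sigma>)"
| "subst_form (Comp u) \<theta> \<sigma> = Comp (subst_agt \<theta> u)"
| "subst_form (Once \<psi>) \<theta> \<sigma> = Once (subst_sform \<theta> \<sigma> \<psi>)"
| "subst_form (State \<psi>) \<theta> \<sigma> = State (subst_sform \<theta> \<sigma> \<psi>)"

definition inst_avar :: "'x \<Rightarrow> ('a, 'x, 'y, 'n) msg \<Rightarrow> ('a, 'x, 'y, 'n, 'p) form
    \<Rightarrow> ('a, 'x, 'y, 'n, 'p) form" where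
  "inst_avar x t \<phi> = subst_form \<phi> ((\<lambda>x. Atm (AVar x))(x := t)) Var"

definition inst_var :: "'y \<Rightarrow> ('a, 'x, 'y, 'n) msg \<Rightarrow> ('a, 'x, 'y, 'n, 'p) form
    \<Rightarrow> ('a, 'x, 'y, 'n, 'p) form" where
  "inst_var y t \<phi> = subst_form \<phi> (\<lambda>x. Atm (AVar x)) (Var(y := t))"

text \<open>
  The agent variables with a free occurrence where the syntax admits only agents and agent
  variables. Replacing such a variable by a ground term yields a formula only if this term is an
  agent.
\<close>

primrec key_avars :: "('a, 'x, 'y, 'n) msg \<Rightarrow> 'x set" where
  "key_avars (Atm u) = {}"
| "key_avars (Var y) = {}"
| "key_avars (Name n) = {}"
| "key_avars (Pub u) = agt_avars u"
| "key_avars (Priv u) = agt_avars u"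
| "key_avars (Shk p) = (\<Union>u\<in>set_uprod p. agt_avars u)"
| "key_avars (Hash t) = key_avars t"
| "key_avars (Encs t1 t2) = key_avars t1 \<union> key_avars t2"
| "key_avars (Enca t1 t2) = key_avars t1 \<union> key_avars t2"
| "key_avars (Sign t1 t2) = key_avars t1 \<union> key_avars t2"
| "key_avars (Pair t1 t2) = key_avars t1 \<union> key_avars t2"

primrec key_avars_sform :: "('a, 'x, 'y, 'n, 'p) sform \<Rightarrow> 'x set" where
  "key_avars_sform STrue = {}"
| "key_avars_sform (SPred p ts) = (\<Union>t\<in>set ts. key_avars t)"
| "key_avars_sform (SNot \<psi>) = key_avars_sform \<psi>"
| "key_avars_sform (SOr \<psi>1 \<psi>2) = key_avars_sform \<psi>1 \<union> key_avars_sform \<psi>2"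

primrec key_avars_form :: "('a, 'x, 'y, 'n, 'p) form \<Rightarrow> 'x set" where
  "key_avars_form (Learn t) = key_avars t"
| "key_avars_form (Neg \<phi>) = key_avars_form \<phi>"
| "key_avars_form (ExA x \<phi>) = key_avars_form \<phi> - {x}"
| "key_avars_form (ExV y \<phi>) = key_avars_form \<phi>"
| "key_avars_form (Or \<phi>1 \<phi>2) = key_avars_form \<phi>1 \<union> key_avars_form \<phi>2"
| "key_avars_form (Comp u) = agt_avars u"
| "key_avars_form (Once \<psi>) = key_avars_sform \<psi>"
| "key_avars_form (State \<psi>) = key_avars_sform \<psi>"

primrec ssat :: "('a, 'x, 'y, 'n, 'p) trace \<Rightarrow> ('a, 'x, 'y, 'n, 'p) sform \<Rightarrow> bool" where
  "ssat exec STrue \<longleftrightarrow> True"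
| "ssat exec (SPred p ts) \<longleftrightarrow> exec \<noteq> [] \<and> fst (last exec) = Status p ts"
| "ssat exec (SNot \<psi>) \<longleftrightarrow> \<not> ssat exec \<psi>"
| "ssat exec (SOr \<psi>1 \<psi>2) \<longleftrightarrow> ssat exec \<psi>1 \<or> ssat exec \<psi>2"

primrec form_depth :: "('a, 'x, 'y, 'n, 'p) form \<Rightarrow> nat" where
  "form_depth (Learn t) = 0"
| "form_depth (Neg \<phi>) = Suc (form_depth \<phi>)"
| "form_depth (ExA x \<phi>) = Suc (form_depth \<phi>)"
| "form_depth (ExV y \<phi>) = Suc (form_depth \<phi>)"
| "form_depth (Or \<phi>1 \<phi>2) = Suc (max (form_depth \<phi>1) (form_depth \<phi>2))"
| "form_depth (Comp u) = 0"
| "form_depth (Once \<psi>) = 0"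
| "form_depth (State \<psi>) = 0"

lemma form_depth_subst [simp]: "form_depth (subst_form \<phi> \<theta> \<sigma>) = form_depth \<phi>"
  by (induction \<phi> arbitrary: \<theta> \<sigma>) auto

lemma form_depth_inst [simp]:
  "form_depth (inst_avar x t \<phi>) = form_depth \<phi>"
  "form_depth (inst_var y t \<phi>) = form_depth \<phi>"
  by (simp_all add: inst_avar_def inst_var_def)

function sat :: "bool \<Rightarrow> 'a \<Rightarrow> 'n set \<Rightarrow> ('a, 'x, 'y, 'n) msg set \<Rightarrow> ('a, 'x, 'y, 'n, 'p) trace
    \<Rightarrow> ('a, 'x, 'y, 'n, 'p) form \<Rightarrow> bool" where
  "sat sg \<epsilon> Ne T0 exec (Learn t) \<longleftrightarrow> deduce sg \<epsilon> Ne (T0 \<union> K exec) t"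
| "sat sg \<epsilon> Ne T0 exec (Neg \<phi>) \<longleftrightarrow> \<not> sat sg \<epsilon> Ne T0 exec \<phi>"
| "sat sg \<epsilon> Ne T0 exec (ExA x \<phi>) \<longleftrightarrow>
     (\<exists>t. ground t \<and> (x \<in> key_avars_form \<phi> \<longrightarrow> t \<in> range (\<lambda>a. Atm (Agt a))) \<and>
          sat sg \<epsilon> Ne T0 exec (inst_avar x t \<phi>))"
| "sat sg \<epsilon> Ne T0 exec (ExV y \<phi>) \<longleftrightarrow>
     (\<exists>t. ground t \<and> sat sg \<epsilon> Ne T0 exec (inst_var y t \<phi>))"
| "sat sg \<epsilon> Ne T0 exec (Or \<phi>1 \<phi>2) \<longleftrightarrow>
     sat sg \<epsilon> Ne T0 exec \<phi>1 \<or> sat sg \<epsilon> Ne T0 exec \<phi>2"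
| "sat sg \<epsilon> Ne T0 exec (Comp u) \<longleftrightarrow> compromised sg \<epsilon> Ne T0 u"
| "sat sg \<epsilon> Ne T0 exec (Once \<psi>) \<longleftrightarrow> (\<exists>i\<le>length exec. ssat (take i exec) \<psi>)"
| "sat sg \<epsilon> Ne T0 exec (State \<psi>) \<longleftrightarrow> ssat exec \<psi>"
  by pat_completeness auto
termination
  by (relation "measure (\<lambda>(_, _, _, _, _, \<phi>). form_depth \<phi>)") auto


section \<open>Transformation\<close>

primrec tag :: "('a, 'x, 'y, 'n) msg \<Rightarrow> ('a, 'x, 'y, 'n) msg \<Rightarrow> ('a, 'x, 'y, 'n) msg" where
  "tag \<tau> (Atm u) = Atm u"
| "tag \<tau> (Var y) = Var y"
| "tag \<tau> (Name n) = Name n"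
| "tag \<tau> (Pub u) = Pub u"
| "tag \<tau> (Priv u) = Priv u"
| "tag \<tau> (Shk p) = Shk p"
| "tag \<tau> (Hash t) = Hash (Pair \<tau> (tag \<tau> t))"
| "tag \<tau> (Encs t1 t2) = Encs (Pair \<tau> (tag \<tau> t1)) (tag \<tau> t2)"
| "tag \<tau> (Enca t1 t2) = Enca (Pair \<tau> (tag \<tau> t1)) (tag \<tau> t2)"
| "tag \<tau> (Sign t1 t2) = Sign (Pair \<tau> (tag \<tau> t1)) (tag \<tau> t2)"
| "tag \<tau> (Pair t1 t2) = Pair (tag \<tau> t1) (tag \<tau> t2)"

text \<open>\<open>z i j\<close> stands for the variable \<open>z\<^sub>i\<^sup>j\<close>, which role \<open>j\<close> uses for the nonce of role \<open>i\<close>.\<close>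

definition fresh_tag_vars ::
  "nat \<Rightarrow> ('a, 'x, 'y, 'n, 'p) protocol \<Rightarrow> (nat \<Rightarrow> nat \<Rightarrow> 'y) \<Rightarrow> bool" where
  "fresh_tag_vars k \<Pi> z \<longleftrightarrow>
     inj_on (\<lambda>(i, j). z i j) ({1..k} \<times> {1..k}) \<and>
     (\<forall>i\<in>{1..k}. \<forall>j\<in>{1..k}. z i j \<notin> protocol_vars k \<Pi>)"

definition tag_part ::
  "(nat \<Rightarrow> nat \<Rightarrow> 'y) \<Rightarrow> ('a, 'x, 'y, 'n, 'p) protocol \<Rightarrow> nat \<Rightarrow> nat \<Rightarrow> ('a, 'x, 'y, 'n) msg" where
  "tag_part z \<Pi> j i = Pair (Atm (AVar (params (\<Pi> j) ! (i - 1)))) (Var (z i j))"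

definition role_tag ::
  "nat \<Rightarrow> (nat \<Rightarrow> nat \<Rightarrow> 'y) \<Rightarrow> ('a, 'x, 'y, 'n, 'p) protocol \<Rightarrow> nat \<Rightarrow> ('a, 'x, 'y, 'n) msg" where
  "role_tag k z \<Pi> j = tuple (map (tag_part z \<Pi> j) [1..<Suc k])"

definition transform ::
  "nat \<Rightarrow> (nat \<Rightarrow> nat \<Rightarrow> 'y) \<Rightarrow> ('a, 'x, 'y, 'n, 'p) protocol \<Rightarrow> ('a, 'x, 'y, 'n, 'p) protocol" where
  "transform k z \<Pi> j =
     Role (params (\<Pi> j)) (nonces (\<Pi> j) @ [z j j])
       (map (\<lambda>i. if i = j then Snd (tag_part z \<Pi> j i) else Rcv (tag_part z \<Pi> j i)) [1..<Suc k]
        @ map (map_event (tag (role_tag k z \<Pi> j)) id) (events (\<Pi> j)))"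


section \<open>Annotated protocols and attack formulas\<close>

abbreviation AV :: "'x \<Rightarrow> ('a, 'x, 'y, 'n) msg" where
  "AV x \<equiv> Atm (AVar x)"

definition annot_secrecy ::
  "nat \<Rightarrow> nat \<Rightarrow> ('a, 'x, 'y, 'n, 'p) protocol \<Rightarrow> ('a, 'x, 'y, 'n, 'p) protocol" where
  "annot_secrecy j h \<Pi> = \<Pi>(j :=
     Role (params (\<Pi> j)) (nonces (\<Pi> j))
       (Status Secret (map AV (params (\<Pi> j)) @ [Var (nonces (\<Pi> j) ! (h - 1))]) # events (\<Pi> j)))"

definition annot_aliveness ::
  "('a, 'x, 'y, 'n, 'p) protocol \<Rightarrow> ('a, 'x, 'y, 'n, 'p) protocol" where
  "annot_aliveness \<Pi> j =
     Role (params (\<Pi> j)) (nonces (\<Pi> j))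
       (Status Start [AV (params (\<Pi> j) ! (j - 1))] # events (\<Pi> j)
        @ [Status End (map AV (params (\<Pi> j)))])"

definition annot_weak_agreement ::
  "('a, 'x, 'y, 'n, 'p) protocol \<Rightarrow> ('a, 'x, 'y, 'n, 'p) protocol" where
  "annot_weak_agreement \<Pi> j =
     Role (params (\<Pi> j)) (nonces (\<Pi> j))
       (map (\<lambda>x. Status Start [AV (params (\<Pi> j) ! (j - 1)), AV x]) (params (\<Pi> j))
        @ events (\<Pi> j) @ [Status (EndRole j) (map AV (params (\<Pi> j)))])"

text \<open>The bound variables of the attack formulas are parameters: any choice will do.\<close>

definition attack_secrecy :: "'x list \<Rightarrow> 'y \<Rightarrow> ('a, 'x, 'y, 'n, 'p) form" where
  "attack_secrecy xs y = foldr ExA xs (ExV y (Conj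
     (Once (SPred Secret (map AV xs @ [Var y])) # map (\<lambda>x. NC (AVar x)) xs @ [Learn (Var y)])))"

definition attack_aliveness :: "'x list \<Rightarrow> ('a, 'x, 'y, 'n, 'p) form" where
  "attack_aliveness xs = foldr ExA xs (Conj
     (State (SPred End (map AV xs)) # map (\<lambda>x. NC (AVar x)) xs
      @ [Disj (map (\<lambda>x. Neg (Once (SPred Start [AV x]))) xs)]))"

definition attack_weak_agreement :: "nat \<Rightarrow> nat \<Rightarrow> 'x list \<Rightarrow> ('a, 'x, 'y, 'n, 'p) form" where
  "attack_weak_agreement i j xs = foldr ExA xs (Conj
     (State (SPred (EndRole j) (map AV xs)) # map (\<lambda>x. NC (AVar x)) xs
      @ [Neg (Once (SPred Start [AV (xs ! (i - 1)), AV (xs ! (j - 1))]))]))"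

definition attack_trace ::
  "bool \<Rightarrow> 'a \<Rightarrow> 'n set \<Rightarrow> ('y \<Rightarrow> nat \<Rightarrow> 'n) \<Rightarrow> ('a, 'x, 'y, 'n) msg set \<Rightarrow> nat
     \<Rightarrow> ('a, 'x, 'y, 'n, 'p) protocol \<Rightarrow> ('a, 'x, 'y, 'n, 'p) form
     \<Rightarrow> (nat \<times> nat) list \<Rightarrow> (nat \<Rightarrow> 'a list) \<Rightarrow> ('a, 'x, 'y, 'n, 'p) trace \<Rightarrow> bool" where
  "attack_trace sg \<epsilon> Ne nonce T0 k \<Pi> \<phi> sc \<alpha> exec \<longleftrightarrow>
     is_exec nonce k \<Pi> sc \<alpha> exec \<and> valid sg \<epsilon> Ne T0 exec \<and> sat sg \<epsilon> Ne T0 exec \<phi>"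

definition one_session_per_role :: "(nat \<times> nat) list \<Rightarrow> bool" where
  "one_session_per_role sc \<longleftrightarrow>
     (\<forall>r sid sid'. (r, sid) \<in> set sc \<and> (r, sid') \<in> set sc \<longrightarrow> sid = sid')"

end

theory Submission
  imports Defs
begin

text \<open>
  Fix the tag \<open>\<tau>\<close> of the attacked session. The sessions whose tag is \<open>\<tau>\<close> involve the same honest
  agents, and there is at most one of them per role, since \<open>\<tau>\<close> contains a nonce generated by each
  role. Keep only their events, and replace in all messages every cryptographic term whose payload
  does not start with \<open>\<tau>\<close>, as well as every nonce of another session, by the agent \<open>\<epsilon>\<close>. The
  patterns of the remaining sessions are compatible with this replacement. It also preserves
  deducibility: another session can only forward payloads that it received in plaintext
  position, so by induction on the trace everything it sends is deducible after the replacement,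
  and so is the payload of each replaced term.
\<close>

section \<open>Purging messages\<close>

text \<open>The agent \<open>\<epsilon>\<close> serves as the replacement for two reasons. The
  attacker can always produce it, so a replacement never has to be paid for in derivability. It is
  also compromised, hence different from every agent of an honest session, so purging cannot turn
  some event of the trace into a new \<open>Start\<close> event about those agents; this keeps the
  negated parts of the attack formulas true. Derivability of the purged term alone is not an
  invariant of the attacker's rules, since a replaced ciphertext says nothing about its payload.
  \<open>harmless\<close> therefore adds \<open>transparent\<close>, which looks only into payloads:
  neither the rules nor \<open>plaintext\<close> extract the second argument of a cryptographic
  operator. Dropped sessions can no longer supply long-term keys; by the hypothesis on
  \<open>lgKeys\<close> and \<open>plaintext\<close>, the keys that they could send in plaintext
  position are known anyway. The received components of \<tau> may contain replaced terms, so the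
  reduced trace carries the tag \<open>purge \<epsilon> N \<tau> \<tau>\<close>, while \<tau> itself
  only decides which terms are kept.\<close>

definition tagged :: "('a, 'x, 'y, 'n) msg \<Rightarrow> ('a, 'x, 'y, 'n) msg \<Rightarrow> bool" where
  "tagged \<tau> t \<longleftrightarrow> (\<exists>u. t = Pair \<tau> u)"

lemma tagged_Pair [simp]: "tagged \<tau> (Pair u v) \<longleftrightarrow> u = \<tau>"
  by (auto simp: tagged_def)

primrec purge :: "'a \<Rightarrow> 'n set \<Rightarrow> ('a, 'x, 'y, 'n) msg \<Rightarrow> ('a, 'x, 'y, 'n) msg
    \<Rightarrow> ('a, 'x, 'y, 'n) msg" where
  "purge \<epsilon> N \<tau> (Atm u) = Atm u"
| "purge \<epsilon> N \<tau> (Var y) = Var y"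
| "purge \<epsilon> N \<tau> (Name n) = (if n \<in> N then Name n else Atm (Agt \<epsilon>))"
| "purge \<epsilon> N \<tau> (Pub u) = Pub u"
| "purge \<epsilon> N \<tau> (Priv u) = Priv u"
| "purge \<epsilon> N \<tau> (Shk p) = Shk p"
| "purge \<epsilon> N \<tau> (Hash t) = (if tagged \<tau> t then Hash (purge \<epsilon> N \<tau> t) else Atm (Agt \<epsilon>))"
| "purge \<epsilon> N \<tau> (Encs t1 t2) =
     (if tagged \<tau> t1 then Encs (purge \<epsilon> N \<tau> t1) (purge \<epsilon> N \<tau> t2) else Atm (Agt \<epsilon>))"
| "purge \<epsilon> N \<tau> (Enca t1 t2) =
     (if tagged \<tau> t1 then Enca (purge \<epsilon> N \<tau> t1) (purge \<epsilon> N \<tau> t2) else Atm (Agt \<epsilon>))"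
| "purge \<epsilon> N \<tau> (Sign t1 t2) =
     (if tagged \<tau> t1 then Sign (purge \<epsilon> N \<tau> t1) (purge \<epsilon> N \<tau> t2) else Atm (Agt \<epsilon>))"
| "purge \<epsilon> N \<tau> (Pair t1 t2) = Pair (purge \<epsilon> N \<tau> t1) (purge \<epsilon> N \<tau> t2)"

text \<open>A replacement only ever produces \<epsilon>, so any other agent must have been there
  before.\<close>

lemma purge_eq_agent: "a \<noteq> \<epsilon> \<Longrightarrow> purge \<epsilon> N \<tau> t = Atm (Agt a) \<Longrightarrow> t = Atm (Agt a)"
  by (cases t) (auto split: if_splits)

lemma ground_purge: "ground t \<Longrightarrow> ground (purge \<epsilon> N \<tau> t)"
  by (induction t) (auto simp: ground_def)

text \<open>
  The payload of a cryptographic message that \<^const>\<open>purge\<close> removes must itself be derivable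
  after purging: the attacker may open the message, or a session may forward its payload.
\<close>

primrec transparent :: "'a \<Rightarrow> 'n set \<Rightarrow> ('a, 'x, 'y, 'n) msg \<Rightarrow> ('a, 'x, 'y, 'n) msg set
    \<Rightarrow> ('a, 'x, 'y, 'n) msg \<Rightarrow> bool" where
  "transparent \<epsilon> N \<tau> D (Atm u) \<longleftrightarrow> True"
| "transparent \<epsilon> N \<tau> D (Var y) \<longleftrightarrow> True"
| "transparent \<epsilon> N \<tau> D (Name n) \<longleftrightarrow> True"
| "transparent \<epsilon> N \<tau> D (Pub u) \<longleftrightarrow> True"
| "transparent \<epsilon> N \<tau> D (Priv u) \<longleftrightarrow> True"
| "transparent \<epsilon> N \<tau> D (Shk p) \<longleftrightarrow> True"
| "transparent \<epsilon> N \<tau> D (Hash t) \<longleftrightarrow>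
     transparent \<epsilon> N \<tau> D t \<and> (tagged \<tau> t \<or> purge \<epsilon> N \<tau> t \<in> D)"
| "transparent \<epsilon> N \<tau> D (Encs t1 t2) \<longleftrightarrow>
     transparent \<epsilon> N \<tau> D t1 \<and> (tagged \<tau> t1 \<or> purge \<epsilon> N \<tau> t1 \<in> D)"
| "transparent \<epsilon> N \<tau> D (Enca t1 t2) \<longleftrightarrow>
     transparent \<epsilon> N \<tau> D t1 \<and> (tagged \<tau> t1 \<or> purge \<epsilon> N \<tau> t1 \<in> D)"
| "transparent \<epsilon> N \<tau> D (Sign t1 t2) \<longleftrightarrow>
     transparent \<epsilon> N \<tau> D t1 \<and> (tagged \<tau> t1 \<or> purge \<epsilon> N \<tau> t1 \<in> D)"
| "transparent \<epsilon> N \<tau> D (Pair t1 t2) \<longleftrightarrow> transparent \<epsilon> N \<tau> D t1 \<and> transparent \<epsilon> N \<tau> D t2"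

definition harmless :: "'a \<Rightarrow> 'n set \<Rightarrow> ('a, 'x, 'y, 'n) msg \<Rightarrow> ('a, 'x, 'y, 'n) msg set
    \<Rightarrow> ('a, 'x, 'y, 'n) msg \<Rightarrow> bool" where
  "harmless \<epsilon> N \<tau> D t \<longleftrightarrow> transparent \<epsilon> N \<tau> D t \<and> purge \<epsilon> N \<tau> t \<in> D"

lemma transparent_mono: "transparent \<epsilon> N \<tau> D t \<Longrightarrow> D \<subseteq> D' \<Longrightarrow> transparent \<epsilon> N \<tau> D' t"
  by (induction t) auto

lemma harmless_mono: "harmless \<epsilon> N \<tau> D t \<Longrightarrow> D \<subseteq> D' \<Longrightarrow> harmless \<epsilon> N \<tau> D' t"
  by (auto simp: harmless_def intro: transparent_mono)

lemma deduce_mono: "deduce sg \<epsilon> Ne T t \<Longrightarrow> T \<subseteq> T' \<Longrightarrow> deduce sg \<epsilon> Ne T' t"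
  by (induction rule: deduce.induct) (auto intro: deduce.intros)

definition derivable :: "bool \<Rightarrow> 'a \<Rightarrow> 'n set \<Rightarrow> ('a, 'x, 'y, 'n) msg set
    \<Rightarrow> ('a, 'x, 'y, 'n) msg set" where
  "derivable sg \<epsilon> Ne T = {t. deduce sg \<epsilon> Ne T t}"

lemma derivable_mono: "T \<subseteq> T' \<Longrightarrow> derivable sg \<epsilon> Ne T \<subseteq> derivable sg \<epsilon> Ne T'"
  by (auto simp: derivable_def intro: deduce_mono)

lemma agent_derivable [simp]: "Atm (Agt a) \<in> derivable sg \<epsilon> Ne T"
  by (simp add: derivable_def deduce.agent)

lemma Pair_derivable [simp]:
  "Pair u v \<in> derivable sg \<epsilon> Ne T \<longleftrightarrow> u \<in> derivable sg \<epsilon> Ne T \<and> v \<in> derivable sg \<epsilon> Ne T"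
  by (auto simp: derivable_def intro: deduce.intros)

lemma harmless_agent [simp]: "harmless \<epsilon> N \<tau> (derivable sg \<epsilon> Ne T) (Atm (Agt a))"
  by (simp add: harmless_def)

lemma harmless_Pair [simp]:
  "harmless \<epsilon> N \<tau> (derivable sg \<epsilon> Ne T) (Pair u v) \<longleftrightarrow>
     harmless \<epsilon> N \<tau> (derivable sg \<epsilon> Ne T) u \<and> harmless \<epsilon> N \<tau> (derivable sg \<epsilon> Ne T) v"
  by (auto simp: harmless_def)

lemma harmless_ground_atom:
  assumes "t \<in> T \<union> eps_keys \<epsilon>" and "t \<in> ground_atoms"
  shows "harmless \<epsilon> N \<tau> (derivable sg \<epsilon> Ne T) t"
  using assms by (auto simp: harmless_def ground_atoms_def derivable_def intro: deduce.intros)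

lemma eps_keys_ground_atoms: "eps_keys \<epsilon> \<subseteq> ground_atoms"
  by (auto simp: eps_keys_def ground_atoms_def)

text \<open>Composition: a new cryptographic term is either kept or becomes \<epsilon>, and its
  payload is derivable because the attacker used it. Decomposition: for a kept term the same rule
  applies after purging, as \<open>purge\<close> fixes \<open>Pub\<close> and \<open>Priv\<close>;
  for a replaced term \<open>transparent\<close> supplies the payload.\<close>

lemma deduce_harmless:
  assumes "deduce sg \<epsilon> Ne T t"
    and "\<And>t. t \<in> T \<Longrightarrow> harmless \<epsilon> N \<tau> (derivable sg \<epsilon> Ne T') t"
  shows "harmless \<epsilon> N \<tau> (derivable sg \<epsilon> Ne T') t"
  using assms(1)
proof (induction rule: deduce.induct)
  case (known t)
  then show ?case by (rule assms(2))
next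
  case (eps_key t)
  then show ?case
    by (intro harmless_ground_atom) (auto intro: subsetD[OF eps_keys_ground_atoms])
next
  case (decs u v)
  then show ?case
    by (cases "tagged \<tau> u")
      (simp_all add: harmless_def derivable_def, blast intro: deduce.decs)
next
  case (deca u w)
  then show ?case
    by (cases "tagged \<tau> u")
      (simp_all add: harmless_def derivable_def, blast intro: deduce.deca)
next
  case (open_sign u v)
  then show ?case
    by (cases "tagged \<tau> u")
      (simp_all add: harmless_def derivable_def, blast intro: deduce.open_sign)
qed (auto simp: harmless_def derivable_def intro: deduce.agent deduce.name deduce.pub
  deduce.pair deduce.encs deduce.enca deduce.sign deduce.hash dest: deduce.fst deduce.snd)

section \<open>Instances of tagged patterns\<close>

text \<open>With a tag other than \<tau> every cryptographic layer of the pattern gets replaced, so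
  \<open>transparent\<close> hands over the payloads layer by layer. Hashes and signatures are
  treated like ciphertexts, because \<open>plaintext\<close> descends through them as well.\<close>

lemma harmless_plaintext:
  assumes "harmless \<epsilon> N \<tau> (derivable sg \<epsilon> Ne T) (subst \<theta> \<nu> (tag \<pi> p))"
    and "subst \<theta> \<nu> \<pi> \<noteq> \<tau>" and "t \<in> plaintext p"
  shows "harmless \<epsilon> N \<tau> (derivable sg \<epsilon> Ne T) (subst \<theta> \<nu> t)"
  using assms(1,3)
proof (induction p)
  case (Pair p1 p2)
  then show ?case by auto
qed (use assms(2) in \<open>simp_all add: harmless_def\<close>)

text \<open>Counterpart for sending: each cryptographic layer collapses to \<epsilon>, so only the
  tag and the plaintext leaves must be derivable, and the keys in second position vanish.\<close>

lemma harmless_tag: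
  assumes "\<And>t. t \<in> plaintext p \<Longrightarrow> harmless \<epsilon> N \<tau> (derivable sg \<epsilon> Ne T) (subst \<theta> \<nu> t)"
    and "harmless \<epsilon> N \<tau> (derivable sg \<epsilon> Ne T) (subst \<theta> \<nu> \<pi>)" and "subst \<theta> \<nu> \<pi> \<noteq> \<tau>"
  shows "harmless \<epsilon> N \<tau> (derivable sg \<epsilon> Ne T) (subst \<theta> \<nu> (tag \<pi> p))"
  using assms(1)
proof (induction p)
  case (Pair p1 p2)
  then show ?case by simp
qed (use assms(2,3) in \<open>simp_all add: harmless_def\<close>)

text \<open>For sessions carrying \<tau>, received payloads may be secret; transparency is all that
  can be passed on from received to sent messages.\<close>

lemma transparent_plaintext:
  assumes "transparent \<epsilon> N \<tau> D (subst \<theta> \<nu> (tag \<pi> p))" and "t \<in> plaintext p"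
  shows "transparent \<epsilon> N \<tau> D (subst \<theta> \<nu> t)"
  using assms by (induction p) auto

lemma transparent_tag:
  assumes "\<And>t. t \<in> plaintext p \<Longrightarrow> transparent \<epsilon> N \<tau> D (subst \<theta> \<nu> t)"
    and "transparent \<epsilon> N \<tau> D (subst \<theta> \<nu> \<pi>)" and "subst \<theta> \<nu> \<pi> = \<tau>"
  shows "transparent \<epsilon> N \<tau> D (subst \<theta> \<nu> (tag \<pi> p))"
  using assms by (induction p) auto

text \<open>If the tag is instantiated to \<tau>, all cryptographic layers of the pattern are kept,
  and purging reaches the leaves, where it acts on the substitution only. A literal name in the
  pattern could be purged, whence \<open>names p = {}\<close>; the last premise handles the tag
  itself, which purging may change.\<close>

lemma purge_subst_tag:
  assumes "names p = {}" and "\<And>x. \<theta> x \<in> range Atm"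
    and "subst \<theta> \<nu> \<pi> = \<tau>" and "purge \<epsilon> N \<tau> \<tau> = subst \<theta> (purge \<epsilon> N \<tau> \<circ> \<nu>) \<pi>"
  shows "purge \<epsilon> N \<tau> (subst \<theta> \<nu> (tag \<pi> p)) = subst \<theta> (purge \<epsilon> N \<tau> \<circ> \<nu>) (tag \<pi> p)"
  using assms(1)
proof (induction p)
  case (Atm u)
  have "purge \<epsilon> N \<tau> (\<theta> x) = \<theta> x" for x
    using assms(2)[of x] by auto
  then show ?case by (cases u) auto
qed (use assms in auto)

text \<open>\<open>tuple []\<close> has no defining equation, hence the side condition here and
  below.\<close>

lemma subst_tuple: "ts \<noteq> [] \<Longrightarrow> subst \<theta> \<nu> (tuple ts) = tuple (map (subst \<theta> \<nu>) ts)"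
  by (induction ts rule: tuple.induct) auto

lemma purge_tuple: "ts \<noteq> [] \<Longrightarrow> purge \<epsilon> N \<tau> (tuple ts) = tuple (map (purge \<epsilon> N \<tau>) ts)"
  by (induction ts rule: tuple.induct) auto

lemma transparent_tuple:
  "ts \<noteq> [] \<Longrightarrow> transparent \<epsilon> N \<tau> D (tuple ts) \<longleftrightarrow> (\<forall>t\<in>set ts. transparent \<epsilon> N \<tau> D t)"
  by (induction ts rule: tuple.induct) auto

lemma harmless_tuple:
  "ts \<noteq> [] \<Longrightarrow> harmless \<epsilon> N \<tau> (derivable sg \<epsilon> Ne T) (tuple ts) \<longleftrightarrow>
     (\<forall>t\<in>set ts. harmless \<epsilon> N \<tau> (derivable sg \<epsilon> Ne T) t)"
  by (induction ts rule: tuple.induct) auto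

text \<open>Equal lengths are essential: the last component of a tuple may itself be a pair.\<close>

lemma tuple_inject: "length ts = length us \<Longrightarrow> tuple ts = tuple us \<Longrightarrow> ts \<noteq> [] \<Longrightarrow> ts = us"
proof (induction ts us rule: list_induct2)
  case (Cons t ts u us)
  then show ?case by (cases ts; cases us) auto
qed simp

lemma plaintext_atomic:
  "t \<in> plaintext p \<Longrightarrow>
     t \<in> range Atm \<union> range Var \<union> range Name \<union> range Pub \<union> range Priv \<union> range Shk"
  by (induction p) auto

lemma plaintext_subset:
  "t \<in> plaintext p \<Longrightarrow> avars t \<subseteq> avars p \<and> names t \<subseteq> names p"
  by (induction p) auto

section \<open>Runs\<close>

text \<open>The symbolic and the ground instantiation of a trace merged into one substitution that
  acts directly on role text.\<close>

definition inst :: "('y \<Rightarrow> nat \<Rightarrow> 'n) \<Rightarrow> ('a, 'x, 'y, 'n, 'p) protocol \<Rightarrow> (nat \<Rightarrow> 'a list)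
    \<Rightarrow> ('y \<times> nat \<Rightarrow> ('a, 'x, 'y, 'n) msg) \<Rightarrow> nat \<Rightarrow> nat
    \<Rightarrow> ('a, 'x, 'y, 'n) msg \<Rightarrow> ('a, 'x, 'y, 'n) msg" where
  "inst nonce P \<alpha> \<sigma> r sid = subst (param_subst (P r) (\<alpha> sid))
     (\<lambda>y. if y \<in> set (nonces (P r)) then Name (nonce y sid) else \<sigma> (y, sid))"

definition run :: "('y \<Rightarrow> nat \<Rightarrow> 'n) \<Rightarrow> ('a, 'x, 'y, 'n, 'p) protocol \<Rightarrow> (nat \<Rightarrow> 'a list)
    \<Rightarrow> ('y \<times> nat \<Rightarrow> ('a, 'x, 'y, 'n) msg) \<Rightarrow> (nat \<times> nat) list
    \<Rightarrow> ('a, 'x, 'y, 'n, 'p) trace" where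
  "run nonce P \<alpha> \<sigma> sc = map (\<lambda>(e, sid). (map_event (subst (\<lambda>x. Atm (AVar x)) \<sigma>) id e, sid))
     (symbolic_trace nonce P sc \<alpha>)"

lemma param_subst_Atm: "param_subst R as x \<in> range Atm"
  by (auto simp: param_subst_def split: option.splits)

lemma subst_agt_AVar [simp]: "subst_agt (\<lambda>x. Atm (AVar x)) u = u"
  by (cases u) auto

text \<open>\<theta> and \<theta>' stand for the same agent substitution at two different types of
  variables, that of symbolic traces and that of ground traces.\<close>

lemma subst_subst:
  assumes "\<And>x. \<exists>u. \<theta> x = Atm u \<and> \<theta>' x = Atm u"
  shows "subst (\<lambda>x. Atm (AVar x)) \<sigma> (subst \<theta> \<nu> t) =
    subst \<theta>' (\<lambda>y. subst (\<lambda>x. Atm (AVar x)) \<sigma> (\<nu> y)) t"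
proof -
  have agt: "subst_agt \<theta> = subst_agt \<theta>'"
  proof
    show "subst_agt \<theta> u = subst_agt \<theta>' u" for u
    proof (cases u)
      case (AVar x)
      then show ?thesis using assms[of x] by auto
    qed simp
  qed
  have atm: "subst (\<lambda>x. Atm (AVar x)) \<sigma> (subst_atm \<theta> u) = subst_atm \<theta>' u" for u
  proof (cases u)
    case (AVar x)
    obtain w where "\<theta> x = Atm w" "\<theta>' x = Atm w" using assms by blast
    then show ?thesis using AVar by (cases w) auto
  qed simp
  show ?thesis
    by (induction t) (auto simp: agt atm uprod.map_comp comp_def)
qed

lemma inst_eq:
  "subst (\<lambda>x. Atm (AVar x)) \<sigma>
     (subst (param_subst (P r) (\<alpha> sid)) (var_subst nonce (P r) sid) t) = inst nonce P \<alpha> \<sigma> r sid t"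
proof -
  have "\<exists>u. param_subst (P r) (\<alpha> sid) x = Atm u \<and> param_subst (P r) (\<alpha> sid) x = Atm u" for x
    by (auto simp: param_subst_def split: option.splits)
  note * = subst_subst[OF this]
  show ?thesis
    unfolding * inst_def
    by (rule arg_cong2[where f = "\<lambda>\<nu> t. subst _ \<nu> t"]) (auto simp: var_subst_def)
qed

text \<open>The position q counts the new entry itself, so \<open>q - 1\<close> is the number of
  earlier entries of the same session.\<close>

lemma symbolic_trace_snoc:
  "symbolic_trace nonce P (sc @ [(r, sid)]) \<alpha> = symbolic_trace nonce P sc \<alpha> @
     [(map_event (subst (param_subst (P r) (\<alpha> sid)) (var_subst nonce (P r) sid)) id
        (events (P r) ! count_list (map snd sc) sid), sid)]"
proof -
  have old: "{j. j \<le> i \<and> snd ((sc @ [(r, sid)]) ! j) = s} = {j. j \<le> i \<and> snd (sc ! j) = s}"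
    if "i < length sc" for i s
    using that by (auto simp: nth_append)
  have "{j. j \<le> length sc \<and> snd ((sc @ [(r, sid)]) ! j) = sid} =
      insert (length sc) {j. j < length (map snd sc) \<and> sid = map snd sc ! j}"
    by (auto simp: nth_append le_less)
  then have new: "card {j. j \<le> length sc \<and> snd ((sc @ [(r, sid)]) ! j) = sid} =
      Suc (count_list (map snd sc) sid)"
    by (simp add: count_list_eq_length_filter length_filter_conv_card)
  show ?thesis
    by (simp add: symbolic_trace_def new) (auto simp: nth_append_left old Let_def case_prod_beta)
qed

lemma run_snoc:
  "run nonce P \<alpha> \<sigma> (sc @ [(r, sid)]) = run nonce P \<alpha> \<sigma> sc @
     [(map_event (inst nonce P \<alpha> \<sigma> r sid) id (events (P r) ! count_list (map snd sc) sid), sid)]"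
  by (auto simp: run_def symbolic_trace_snoc event.map_comp comp_def inst_eq id_def
    intro!: event.map_cong)

lemma run_Nil [simp]: "run nonce P \<alpha> \<sigma> [] = []"
  by (simp add: run_def symbolic_trace_def)

lemma count_list_filter: "f x \<Longrightarrow> count_list (filter f xs) x = count_list xs x"
  by (induction xs) auto

text \<open>Positions are counted within a session, so deleting other sessions as a whole does not
  shift them.\<close>

lemma symbolic_trace_filter:
  "symbolic_trace nonce P (filter (\<lambda>x. snd x \<in> S) sc) \<alpha> =
     filter (\<lambda>x. snd x \<in> S) (symbolic_trace nonce P sc \<alpha>)"
proof (induction sc rule: rev_induct)
  case Nil
  show ?case by (simp add: symbolic_trace_def)
next
  case (snoc x sc)
  obtain r sid where x: "x = (r, sid)" by (cases x)
  have "count_list (map snd (filter (\<lambda>x. snd x \<in> S) sc)) sid = count_list (map snd sc) sid"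
    if "sid \<in> S"
    using that count_list_filter[of "\<lambda>s. s \<in> S" sid "map snd sc"]
    by (simp add: filter_map comp_def)
  then show ?case
    using snoc by (simp add: x symbolic_trace_snoc)
qed

lemma run_filter:
  "run nonce P \<alpha> \<sigma> (filter (\<lambda>x. snd x \<in> S) sc) = filter (\<lambda>x. snd x \<in> S) (run nonce P \<alpha> \<sigma> sc)"
  by (simp add: run_def symbolic_trace_filter filter_map comp_def case_prod_beta)

section \<open>Validity, event positions and scenarios, one event at a time\<close>

text \<open>The prefix in \<open>valid\<close> includes the receive event itself, which adds nothing
  to \<open>K\<close>.\<close>

lemma valid_snoc:
  fixes tr :: "('a, 'x, 'y, 'n, 'p) trace"
  shows "valid sg \<epsilon> Ne T0 (tr @ [x]) \<longleftrightarrow> valid sg \<epsilon> Ne T0 tr \<and>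
     (\<forall>m. fst x = Rcv m \<longrightarrow> deduce sg \<epsilon> Ne (T0 \<union> K tr) m)" (is "?L \<longleftrightarrow> ?R")
proof -
  have K: "K (tr @ [x]) = K tr" if "fst x = Rcv m" for m
    using that by (auto simp: K_def)
  have valid_iff: "valid sg \<epsilon> Ne T0 tr \<longleftrightarrow> (\<forall>i<length tr. \<forall>m. fst (tr ! i) = Rcv m \<longrightarrow>
      deduce sg \<epsilon> Ne (T0 \<union> K (take (Suc i) tr)) m)" for tr :: "('a, 'x, 'y, 'n, 'p) trace"
    unfolding valid_def
    by (metis One_nat_def Suc_le_eq Suc_pred diff_Suc_1 le_add1 plus_1_eq_Suc)
  show ?thesis
    by (auto simp: valid_iff All_less_Suc nth_append_left K)
qed

lemma valid_Rcv:
  assumes "valid sg \<epsilon> Ne T0 tr" and "(Rcv m, sid) \<in> set tr"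
  shows "deduce sg \<epsilon> Ne (T0 \<union> K tr) m"
  using assms
proof (induction tr rule: rev_induct)
  case (snoc x tr)
  have "K tr \<subseteq> K (tr @ [x])" by (auto simp: K_def)
  moreover have "deduce sg \<epsilon> Ne (T0 \<union> K tr) m"
    using snoc by (cases x) (auto simp: valid_snoc)
  ultimately show ?case by (rule_tac deduce_mono) auto
qed simp

text \<open>Since \<open>rl\<close> fixes one role per session, all entries of a session read the
  same event list, in order.\<close>

lemma run_earlier_event:
  assumes "\<And>x. x \<in> set sc \<Longrightarrow> fst x = rl (snd x)"
    and "i < count_list (map snd sc) sid"
  shows "(map_event (inst nonce P \<alpha> \<sigma> (rl sid) sid) id (events (P (rl sid)) ! i), sid)
    \<in> set (run nonce P \<alpha> \<sigma> sc)"
  using assms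
proof (induction sc rule: rev_induct)
  case (snoc x sc)
  obtain r s where x: "x = (r, s)" by (cases x)
  show ?case
  proof (cases "i < count_list (map snd sc) sid")
    case True
    then show ?thesis using snoc by (auto simp: x run_snoc)
  next
    case False
    then have "s = sid" and i: "i = count_list (map snd sc) sid"
      using snoc.prems(2) by (auto simp: x split: if_splits)
    moreover have "r = rl s" using snoc.prems(1)[of x] by (simp add: x)
    ultimately have x': "x = (rl sid, sid)" by (simp add: x)
    show ?thesis unfolding run_snoc i x' set_append by (intro UnI2 list.set_intros(1))
  qed
qed simp

lemma is_scenario_iff:
  "is_scenario k P sc \<longleftrightarrow>
     (\<forall>x\<in>set sc. fst x \<in> {1..k} \<and> snd x \<noteq> 0 \<and> count_list sc x \<le> length (events (P (fst x)))) \<and>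
     (\<forall>x\<in>set sc. \<forall>x'\<in>set sc. snd x = snd x' \<longrightarrow> fst x = fst x')"
  by (simp add: is_scenario_def case_prod_beta)

lemma is_scenario_snoc:
  assumes "is_scenario k P (sc @ [(r, sid)])"
  shows "is_scenario k P sc" and "r \<in> {1..k}"
    and "count_list (map snd sc) sid < length (events (P r))"
proof -
  let ?sc = "sc @ [(r, sid)]"
  from assms have 1: "\<forall>x\<in>set ?sc. fst x \<in> {1..k} \<and> snd x \<noteq> 0 \<and>
      count_list ?sc x \<le> length (events (P (fst x)))"
    and 2: "\<forall>x\<in>set ?sc. \<forall>x'\<in>set ?sc. snd x = snd x' \<longrightarrow> fst x = fst x'"
    unfolding is_scenario_iff by blast+
  from 1 show "r \<in> {1..k}" by simp
  show "is_scenario k P sc"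
    unfolding is_scenario_iff
  proof (intro conjI ballI impI)
    fix x assume "x \<in> set sc"
    then have *: "x \<in> set ?sc" by simp
    with 1 show "fst x \<in> {1..k}" "snd x \<noteq> 0" by blast+
    have "count_list sc x \<le> count_list ?sc x" by simp
    also have "\<dots> \<le> length (events (P (fst x)))" using 1 * by blast
    finally show "count_list sc x \<le> length (events (P (fst x)))" .
    fix x' assume "x' \<in> set sc" "snd x = snd x'"
    moreover from this have "x' \<in> set ?sc" by simp
    ultimately show "fst x = fst x'" using 2 * by blast
  qed
  \<comment> \<open>A session plays a single role, so counting its identifier, as traces do, agrees
    with counting the pair, as scenarios do.\<close>
  have "\<forall>x\<in>set sc. snd x = sid \<longrightarrow> x = (r, sid)"
  proof (intro ballI impI)
    fix x assume "x \<in> set sc" "snd x = sid"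
    then have "x \<in> set ?sc" "(r, sid) \<in> set ?sc" "snd x = snd (r, sid)" by simp_all
    with 2 have "fst x = fst (r, sid)" by blast
    with \<open>snd x = sid\<close> show "x = (r, sid)" by (simp add: prod_eq_iff)
  qed
  then have "filter (\<lambda>x. sid = snd x) sc = filter ((=) (r, sid)) sc"
    by (intro filter_cong) auto
  then have "count_list (map snd sc) sid = count_list sc (r, sid)"
    by (simp add: count_list_eq_length_filter filter_map comp_def)
  moreover have "count_list ?sc (r, sid) \<le> length (events (P r))"
    using bspec[OF 1, of "(r, sid)"] by simp
  ultimately show "count_list (map snd sc) sid < length (events (P r))"
    by simp
qed

lemma run_event_origin:
  assumes "is_scenario k P sc" and "(e, sid) \<in> set (run nonce P \<alpha> \<sigma> sc)"
  obtains r e' where "(r, sid) \<in> set sc" and "r \<in> {1..k}" and "e' \<in> set (events (P r))"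
    and "e = map_event (inst nonce P \<alpha> \<sigma> r sid) id e'"
  using assms
proof (induction sc arbitrary: thesis rule: rev_induct)
  case (snoc x sc)
  obtain r s where x: "x = (r, s)" by (cases x)
  note sc = is_scenario_snoc[OF snoc.prems(2)[unfolded x]]
  from snoc.prems(3) consider "(e, sid) \<in> set (run nonce P \<alpha> \<sigma> sc)"
    | "s = sid" "e = map_event (inst nonce P \<alpha> \<sigma> r sid) id (events (P r) ! count_list (map snd sc) sid)"
    unfolding x run_snoc set_append by fastforce
  then show ?case
  proof cases
    case 1
    with snoc.IH[OF _ sc(1)] snoc.prems(1) show ?thesis by (metis Un_iff set_append)
  next
    case 2
    show ?thesis
      by (rule snoc.prems(1)[OF _ sc(2) nth_mem[OF sc(3)]])
        (simp_all only: x 2 set_append list.set Un_iff insert_iff simp_thms)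
  qed
qed simp

lemma is_exec_iff:
  "is_exec nonce k P sc \<alpha> exec \<longleftrightarrow> is_scenario k P sc \<and> (\<forall>sid. length (\<alpha> sid) = k) \<and>
     (\<exists>\<sigma>. (\<forall>(e, sid)\<in>set (symbolic_trace nonce P sc \<alpha>). \<forall>v\<in>ev_vars e. ground (\<sigma> v)) \<and>
          exec = run nonce P \<alpha> \<sigma> sc)"
  by (simp add: is_exec_def run_def)

section \<open>Shape of the transformed roles\<close>

lemma params_transform [simp]: "params (transform k z Q r) = params (Q r)"
  by (simp add: transform_def)

lemma nonces_transform [simp]: "nonces (transform k z Q r) = nonces (Q r) @ [z r r]"
  by (simp add: transform_def)

lemma events_transform_prefix:
  "i < k \<Longrightarrow> events (transform k z Q r) ! i =
     (if Suc i = r then Snd (tag_part z Q r r) else Rcv (tag_part z Q r (Suc i)))"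
  by (auto simp: transform_def nth_append simp del: upt_Suc)

lemma events_transform_suffix:
  "i < length (events (Q r)) \<Longrightarrow> events (transform k z Q r) ! (k + i) =
     map_event (tag (role_tag k z Q r)) id (events (Q r) ! i)"
  by (auto simp: transform_def nth_append simp del: upt_Suc)

lemma length_events_transform [simp]:
  "length (events (transform k z Q r)) = k + length (events (Q r))"
  by (simp add: transform_def del: upt_Suc)

section \<open>Reduction to the sessions with one tag\<close>

text \<open>\<open>Q\<close> is an annotated protocol before the transformation. Origination and the
  key condition are required for sends only, since status events do not add to the attacker's
  knowledge. \<open>rl\<close> and \<tau> stay arbitrary until an attacked session is
  chosen.\<close>

locale tagged_run =
  fixes sg :: bool
    and \<epsilon> :: 'a
    and Ne :: "'n set"
    and nonce :: "'y \<Rightarrow> nat \<Rightarrow> 'n"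
    and k :: nat
    and Q :: "('a, 'x, 'y, 'n, 'p) protocol"
    and z :: "nat \<Rightarrow> nat \<Rightarrow> 'y"
    and T0 :: "('a, 'x, 'y, 'n) msg set"
    and \<alpha> :: "nat \<Rightarrow> 'a list"
    and \<sigma> :: "'y \<times> nat \<Rightarrow> ('a, 'x, 'y, 'n) msg"
    and rl :: "nat \<Rightarrow> nat"
    and \<tau> :: "('a, 'x, 'y, 'n) msg"
  assumes distinct_params: "r \<in> {1..k} \<Longrightarrow> distinct (params (Q r))"
    and length_params: "r \<in> {1..k} \<Longrightarrow> length (params (Q r)) = k"
    and no_names: "r \<in> {1..k} \<Longrightarrow> t \<in> role_terms (Q r) \<Longrightarrow> names t = {}"
    and avars_params: "r \<in> {1..k} \<Longrightarrow> t \<in> role_terms (Q r) \<Longrightarrow> avars t \<subseteq> set (params (Q r))"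
    and origination: "r \<in> {1..k} \<Longrightarrow> i < length (events (Q r)) \<Longrightarrow> events (Q r) ! i = Snd p \<Longrightarrow>
      Var y \<in> plaintext p \<Longrightarrow> y \<notin> set (nonces (Q r)) \<Longrightarrow>
      \<exists>j<i. \<exists>p'. events (Q r) ! j = Rcv p' \<and> Var y \<in> plaintext p'"
    and plaintext_keys: "r \<in> {1..k} \<Longrightarrow> Snd p \<in> set (events (Q r)) \<Longrightarrow> t \<in> plaintext p \<Longrightarrow>
      t \<in> range Priv \<union> range Shk \<Longrightarrow> t \<in> T0 \<union> eps_keys \<epsilon>"
    and T0: "T0 \<subseteq> ground_atoms"
    and fresh: "fresh_nonces Ne k (transform k z Q) nonce"
    and length_\<alpha>: "length (\<alpha> sid) = k"
begin

abbreviation P where "P \<equiv> transform k z Q"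

abbreviation I where "I \<equiv> inst nonce P \<alpha> \<sigma>"

text \<open>The tag is read off \<sigma>, so membership also makes sense for a session that has not
  finished exchanging tag parts, or that is absent from the scenario.\<close>

definition S :: "nat set" where
  "S = {sid. rl sid \<in> {1..k} \<and> I (rl sid) sid (role_tag k z Q (rl sid)) = \<tau>}"

definition N :: "'n set" where
  "N = {nonce y sid | y sid. sid \<in> S \<and> y \<in> set (nonces (P (rl sid)))}"

abbreviation \<rho> where "\<rho> \<equiv> purge \<epsilon> N \<tau>"

abbreviation R where "R \<equiv> run nonce P \<alpha>"

definition restrict :: "('a, 'x, 'y, 'n, 'p) trace \<Rightarrow> ('a, 'x, 'y, 'n, 'p) trace" where
  "restrict tr = map (\<lambda>(e, sid). (map_event \<rho> id e, sid)) (filter (\<lambda>x. snd x \<in> S) tr)"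

definition D :: "('a, 'x, 'y, 'n, 'p) trace \<Rightarrow> ('a, 'x, 'y, 'n) msg set" where
  "D tr = derivable sg \<epsilon> Ne (T0 \<union> K (restrict tr))"

lemma D_mono: "set tr \<subseteq> set tr' \<Longrightarrow> D tr \<subseteq> D tr'"
proof -
  assume "set tr \<subseteq> set tr'"
  then have "set (restrict tr) \<subseteq> set (restrict tr')"
    unfolding restrict_def set_map set_filter by (intro image_mono) auto
  then show ?thesis
    unfolding D_def by (intro derivable_mono Un_mono) (auto simp: K_def)
qed

lemma foreign_nonce:
  assumes "sid \<notin> S" and "rl sid \<in> {1..k}" and "y \<in> set (nonces (P (rl sid)))"
  shows "nonce y sid \<notin> N"
proof
  assume "nonce y sid \<in> N"
  then obtain y' sid' where *: "nonce y sid = nonce y' sid'" "sid' \<in> S"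
    "y' \<in> set (nonces (P (rl sid')))"
    by (auto simp: N_def)
  then have "rl sid' \<in> {1..k}" by (simp add: S_def)
  then have "y \<in> protocol_nonces k P" "y' \<in> protocol_nonces k P"
    using assms * unfolding protocol_nonces_def by blast+
  then have "(y, sid) = (y', sid')"
    using fresh *(1) unfolding fresh_nonces_def
    by (intro inj_onD[of "\<lambda>(y, sid). nonce y sid"]) auto
  with * assms show False by simp
qed

lemma inst_param:
  assumes "r \<in> {1..k}" and "x \<in> set (params (Q r))"
  shows "\<exists>a. param_subst (P r) (\<alpha> sid) x = Atm (Agt a)"
proof -
  have "x \<in> dom (map_of (zip (params (P r)) (\<alpha> sid)))"
    using assms length_params length_\<alpha> by simp
  then show ?thesis by (auto simp: param_subst_def)
qed

lemma inst_tag_part: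
  assumes "r \<in> {1..k}" and "i \<in> {1..k}"
  shows "I r sid (tag_part z Q r i) = Pair (Atm (Agt (\<alpha> sid ! (i - 1)))) (I r sid (Var (z i r)))"
proof -
  have "map_of (zip (params (Q r)) (\<alpha> sid)) (params (Q r) ! (i - 1)) = Some (\<alpha> sid ! (i - 1))"
    using assms length_params distinct_params length_\<alpha> by (intro map_of_zip_nth) auto
  then show ?thesis
    by (simp add: tag_part_def inst_def param_subst_def)
qed

lemma inst_role_tag:
  assumes "r \<in> {1..k}"
  shows "I r sid (role_tag k z Q r) = tuple (map (\<lambda>i. I r sid (tag_part z Q r i)) [1..<Suc k])"
  using assms by (simp add: role_tag_def inst_def subst_tuple comp_def del: upt_Suc)

section \<open>Purging commutes with instantiation\<close>

text \<open>The nonces of a session in \<open>S\<close> lie in \<open>N\<close>, so purging leaves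
  them alone and changes only \<sigma>.\<close>

lemma inst_purge:
  assumes "sid \<in> S"
  shows "inst nonce P \<alpha> (\<rho> \<circ> \<sigma>) (rl sid) sid = subst (param_subst (P (rl sid)) (\<alpha> sid))
    (\<rho> \<circ> (\<lambda>y. if y \<in> set (nonces (P (rl sid))) then Name (nonce y sid) else \<sigma> (y, sid)))"
proof -
  have "nonce y sid \<in> N" if "y \<in> set (nonces (P (rl sid)))" for y
    using assms that unfolding N_def by blast
  then show ?thesis
    unfolding inst_def by (intro arg_cong[where f = "subst _"] ext) simp
qed

lemma purge_inst_tag_part:
  assumes "sid \<in> S"
  shows "\<rho> (I (rl sid) sid (tag_part z Q (rl sid) i)) =
    inst nonce P \<alpha> (\<rho> \<circ> \<sigma>) (rl sid) sid (tag_part z Q (rl sid) i)"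
proof -
  have "\<rho> (param_subst (P (rl sid)) (\<alpha> sid) x) = param_subst (P (rl sid)) (\<alpha> sid) x" for x
    using param_subst_Atm[of "P (rl sid)" "\<alpha> sid" x] by (metis purge.simps(1) rangeE)
  then show ?thesis
    unfolding inst_purge[OF assms] by (simp add: tag_part_def inst_def)
qed

lemma purge_inst_event:
  assumes "sid \<in> S" and "e \<in> set (events (P (rl sid)))"
  shows "map_event \<rho> id (map_event (I (rl sid) sid) id e) =
    map_event (inst nonce P \<alpha> (\<rho> \<circ> \<sigma>) (rl sid) sid) id e"
proof -
  let ?r = "rl sid" and ?I' = "inst nonce P \<alpha> (\<rho> \<circ> \<sigma>) (rl sid) sid"
  have r: "?r \<in> {1..k}" and \<tau>: "I ?r sid (role_tag k z Q ?r) = \<tau>"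
    using assms by (auto simp: S_def)
  \<comment> \<open>Purged componentwise, \<tau> becomes the tag of the same session under
    \<open>\<rho> \<circ> \<sigma>\<close>, which is the premise about the tag in
    \<open>purge_subst_tag\<close>.\<close>
  have tag: "\<rho> (I ?r sid (role_tag k z Q ?r)) = ?I' (role_tag k z Q ?r)"
    using r purge_inst_tag_part[OF assms(1)]
    by (simp add: inst_role_tag purge_tuple comp_def del: upt_Suc)
      (simp add: role_tag_def inst_def subst_tuple comp_def del: upt_Suc)
  have "\<rho> (I ?r sid t) = ?I' t" if "t \<in> terms_in e" for t
  proof -
    from assms(2) consider i where "t = tag_part z Q ?r i"
      | p where "t = tag (role_tag k z Q ?r) p" "p \<in> role_terms (Q ?r)"
      using \<open>t \<in> terms_in e\<close>
      by (fastforce simp: transform_def role_terms_def event.set_map split: if_splits)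
    then show ?thesis
    proof cases
      case 1
      then show ?thesis using purge_inst_tag_part[OF assms(1)] by simp
    next
      case 2
      then show ?thesis
        using no_names[OF r] \<tau> tag unfolding inst_purge[OF assms(1)]
        by (simp add: inst_def purge_subst_tag param_subst_Atm)
    qed
  qed
  then show ?thesis
    by (auto simp: event.map_comp intro!: event.map_cong)
qed

definition consistent :: "(nat \<times> nat) list \<Rightarrow> bool" where
  "consistent sc \<longleftrightarrow> is_scenario k P sc \<and> (\<forall>x\<in>set sc. fst x = rl (snd x))"

lemma consistent_snoc:
  assumes "consistent (sc @ [(r, sid)])"
  shows "consistent sc" and "r = rl sid" and "r \<in> {1..k}"
    and "count_list (map snd sc) sid < length (events (P r))"
proof -
  from assms have sc: "is_scenario k P (sc @ [(r, sid)])"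
    and rl: "\<forall>x\<in>set (sc @ [(r, sid)]). fst x = rl (snd x)"
    unfolding consistent_def by blast+
  note is_scenario_snoc[OF sc]
  with rl show "consistent sc" "r = rl sid" "r \<in> {1..k}"
    "count_list (map snd sc) sid < length (events (P r))"
    unfolding consistent_def by auto
qed

text \<open>This makes the purged trace a genuine instance of a symbolic trace: the scenario is the
  filtered one and the substitution is \<open>\<rho> \<circ> \<sigma>\<close>.\<close>

lemma run_purge:
  assumes "consistent sc"
  shows "R (\<rho> \<circ> \<sigma>) (filter (\<lambda>x. snd x \<in> S) sc) = restrict (R \<sigma> sc)"
  using assms
proof (induction sc rule: rev_induct)
  case (snoc x sc)
  obtain r sid where x: "x = (r, sid)" by (cases x)
  note c = consistent_snoc[OF snoc.prems[unfolded x]]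
  have "R (\<rho> \<circ> \<sigma>) (filter (\<lambda>x. snd x \<in> S) (sc @ [x])) =
      filter (\<lambda>x. snd x \<in> S) (R (\<rho> \<circ> \<sigma>) (sc @ [x]))"
    by (rule run_filter)
  also have "\<dots> = R (\<rho> \<circ> \<sigma>) (filter (\<lambda>x. snd x \<in> S) sc) @ filter (\<lambda>x. snd x \<in> S)
      [(map_event (inst nonce P \<alpha> (\<rho> \<circ> \<sigma>) r sid) id (events (P r) ! count_list (map snd sc) sid), sid)]"
    unfolding x run_snoc filter_append run_filter ..
  also have "\<dots> = restrict (R \<sigma> (sc @ [x]))"
  proof (cases "sid \<in> S")
    case True
    then have "map_event \<rho> id (map_event (I r sid) id (events (P r) ! count_list (map snd sc) sid)) =
        map_event (inst nonce P \<alpha> (\<rho> \<circ> \<sigma>) r sid) id (events (P r) ! count_list (map snd sc) sid)"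
      unfolding c(2) using c(2,4) by (intro purge_inst_event nth_mem) simp_all
    with True show ?thesis
      by (simp add: x run_snoc snoc.IH[OF c(1)] restrict_def del: events_transform_suffix)
  next
    case False
    then show ?thesis
      by (simp add: x run_snoc snoc.IH[OF c(1)] restrict_def)
  qed
  finally show ?case .
qed (simp add: restrict_def)

section \<open>The attacker's knowledge survives purging\<close>

lemma nonce_transparent_harmless:
  assumes "rl sid \<in> {1..k}" and "y \<in> set (nonces (P (rl sid)))"
  shows "transparent \<epsilon> N \<tau> D' (I (rl sid) sid (Var y))"
    and "sid \<notin> S \<Longrightarrow> harmless \<epsilon> N \<tau> (derivable sg \<epsilon> Ne T) (I (rl sid) sid (Var y))"
proof -
  have I: "I (rl sid) sid (Var y) = Name (nonce y sid)"
    using assms(2) by (auto simp: inst_def)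
  show "transparent \<epsilon> N \<tau> D' (I (rl sid) sid (Var y))"
    by (simp add: I)
  show "harmless \<epsilon> N \<tau> (derivable sg \<epsilon> Ne T) (I (rl sid) sid (Var y))" if "sid \<notin> S"
    using foreign_nonce[OF that assms] by (simp add: I harmless_def)
qed

text \<open>A session in \<open>S\<close> only needs to send transparent messages, since its purged
  sends enter the knowledge of the restricted trace. A session outside \<open>S\<close> loses its
  sends, so these must be derivable from what it received.\<close>

lemma sent_message:
  fixes U :: "('a, 'x, 'y, 'n) msg set"
  defines "H \<equiv> harmless \<epsilon> N \<tau> (derivable sg \<epsilon> Ne (T0 \<union> U))"
    and "Tr \<equiv> transparent \<epsilon> N \<tau> (derivable sg \<epsilon> Ne (T0 \<union> U))"
  assumes sc: "consistent (sc @ [(r, sid)])"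
    and m: "events (P r) ! count_list (map snd sc) sid = Snd m"
    and rcv: "\<And>m'. (Rcv m', sid) \<in> set (R \<sigma> sc) \<Longrightarrow> H m'"
  shows "Tr (I r sid m) \<and> (sid \<notin> S \<longrightarrow> H (I r sid m))"
proof -
  let ?q = "count_list (map snd sc) sid" and ?\<pi> = "role_tag k z Q r"
  let ?\<theta> = "param_subst (P r) (\<alpha> sid) :: 'x \<Rightarrow> ('a, 'x, 'y, 'n) msg"
  note r = consistent_snoc(2,3)[OF sc]
  have Tr: "H t \<Longrightarrow> Tr t" for t
    by (simp add: H_def Tr_def harmless_def)
  have earlier: "H (I r sid m')" if "i < ?q" "events (P r) ! i = Rcv m'" for i m'
  proof -
    have "(map_event (I (rl sid) sid) id (events (P (rl sid)) ! i), sid) \<in> set (R \<sigma> sc)"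
      using consistent_snoc(1)[OF sc] that(1) unfolding consistent_def
      by (intro run_earlier_event) auto
    with that(2) show ?thesis by (intro rcv) (simp add: r)
  qed
  have nonce: "Tr (I r sid (Var y)) \<and> (sid \<notin> S \<longrightarrow> H (I r sid (Var y)))"
    if "y \<in> set (nonces (P r))" for y
    using nonce_transparent_harmless[of sid y] that r unfolding H_def Tr_def by blast
  \<comment> \<open>\<open>i - 1\<close> is the position, counted from 0, of tag part i in the
    initial exchange: the part is the session's own or has already been received.\<close>
  have part: "Tr (I r sid (tag_part z Q r i)) \<and> (sid \<notin> S \<longrightarrow> H (I r sid (tag_part z Q r i)))"
    if "i \<in> {1..k}" "i = r \<or> i - 1 < ?q" for i
  proof (cases "i = r")
    case True
    then show ?thesis
      using nonce[of "z r r"] inst_tag_part[OF r(2) that(1)] by (simp add: H_def Tr_def)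
  next
    case False
    then have "events (P r) ! (i - 1) = Rcv (tag_part z Q r i)"
      using that(1) by (subst events_transform_prefix) auto
    then show ?thesis
      using earlier that(2) False Tr by blast
  qed
  show ?thesis
  proof (cases "?q < k")
    case True
    \<comment> \<open>The only send among the first k events is that of the session's own tag
      part.\<close>
    then have "m = tag_part z Q r r"
      using m by (simp add: events_transform_prefix split: if_splits)
    then show ?thesis using part[of r] r(2) by simp
  next
    case False
    define i where "i = ?q - k"
    have q: "?q = k + i" using False by (simp add: i_def)
    have i: "i < length (events (Q r))"
      using consistent_snoc(4)[OF sc] by (simp add: q)
    then obtain p where p: "events (Q r) ! i = Snd p" and m: "m = tag ?\<pi> p"
      using m unfolding q by (cases "events (Q r) ! i") (auto simp: events_transform_suffix)
    have p_in: "Snd p \<in> set (events (Q r))"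
      using i p by (metis nth_mem)
    then have p_role: "p \<in> role_terms (Q r)"
      by (force simp: role_terms_def)
    \<comment> \<open>The leaves that a send exposes are agents, public keys, known long-term keys,
      nonces of the session, or variables received earlier in plaintext position.\<close>
    have plain: "Tr (I r sid t) \<and> (sid \<notin> S \<longrightarrow> H (I r sid t))" if t: "t \<in> plaintext p" for t
    proof -
      have avars: "avars t \<subseteq> set (params (Q r))" and names: "names t = {}"
        using plaintext_subset[OF t] avars_params[OF r(2) p_role] no_names[OF r(2) p_role] by auto
      have agt: "\<exists>a. subst_agt ?\<theta> u = Agt a \<and> subst_atm ?\<theta> u = Atm (Agt a)"
        if "agt_avars u \<subseteq> set (params (Q r))" for u
      proof (cases u)
        case (AVar x)
        with that obtain a where "?\<theta> x = Atm (Agt a)"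
          using inst_param[OF r(2), of x sid] by auto
        with AVar show ?thesis by simp
      qed simp
      from plaintext_atomic[OF t] consider u where "t = Atm u" | u where "t = Pub u"
        | n where "t = Name n" | "t \<in> range Priv \<union> range Shk" | y where "t = Var y"
        by blast
      then show ?thesis
      proof cases
        case 1
        with avars have "agt_avars u \<subseteq> set (params (Q r))" by simp
        from agt[OF this] 1 show ?thesis by (auto simp: inst_def H_def Tr_def)
      next
        case 2
        with avars have "agt_avars u \<subseteq> set (params (Q r))" by simp
        from agt[OF this] 2 show ?thesis
          by (auto simp: inst_def H_def Tr_def harmless_def derivable_def intro: deduce.pub)
      next
        case 3
        with names show ?thesis by simp
      next
        case 4
        then have known: "t \<in> T0 \<union> eps_keys \<epsilon>"
          using plaintext_keys[OF r(2) p_in t] by blast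
        \<comment> \<open>Being known forces the key in the pattern to be ground, so instantiation
          does not change it.\<close>
        then have atom: "t \<in> ground_atoms"
          using T0 eps_keys_ground_atoms by (metis UnE subsetD)
        then have "I r sid t = t"
          using 4 by (auto simp: ground_atoms_def inst_def)
        then show ?thesis
          using known atom harmless_ground_atom[of t "T0 \<union> U"] Tr by (auto simp: H_def)
      next
        case 5
        show ?thesis
        proof (cases "y \<in> set (nonces (P r))")
          case True
          then show ?thesis using 5 nonce by simp
        next
          case False
          then have "y \<notin> set (nonces (Q r))" by simp
          \<comment> \<open>Origination in plaintext position provides a received pattern out of
            which y can be peeled, layer by layer.\<close>
          then obtain j p' where j: "j < i" and p': "events (Q r) ! j = Rcv p'" "t \<in> plaintext p'"
            using origination[OF r(2) i p, of y] t 5 by blast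
          have "events (P r) ! (k + j) = Rcv (tag ?\<pi> p')"
            using i j p' by (simp add: events_transform_suffix)
          then have H: "H (I r sid (tag ?\<pi> p'))"
            using earlier[of "k + j"] j q by simp
          have "Tr (I r sid t)"
            using Tr[OF H] p'(2) unfolding Tr_def inst_def by (rule transparent_plaintext)
          moreover have "H (I r sid t)" if "sid \<notin> S"
          proof -
            have "I r sid ?\<pi> \<noteq> \<tau>" using that r by (simp add: S_def)
            from H this p'(2) show ?thesis
              unfolding H_def inst_def by (rule harmless_plaintext)
          qed
          ultimately show ?thesis by blast
        qed
      qed
    qed
    have "Tr (I r sid ?\<pi>) \<and> (sid \<notin> S \<longrightarrow> H (I r sid ?\<pi>))"
    proof -
      have "Tr (I r sid (tag_part z Q r j)) \<and> (sid \<notin> S \<longrightarrow> H (I r sid (tag_part z Q r j)))"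
        if "j \<in> set [1..<Suc k]" for j
      proof (rule part)
        show "j \<in> {1..k}" using that by auto
        then show "j = r \<or> j - 1 < ?q" by (auto simp: q)
      qed
      then show ?thesis
        using r(2) unfolding inst_role_tag[OF r(2)] Tr_def H_def
        by (simp add: transparent_tuple harmless_tuple del: upt_Suc set_upt)
    qed
    moreover have "sid \<in> S \<longleftrightarrow> I r sid ?\<pi> = \<tau>"
      using r by (simp add: S_def)
    ultimately have "Tr (I r sid m)" if "sid \<in> S"
      using that plain unfolding m Tr_def inst_def by (intro transparent_tag) blast+
    moreover have "H (I r sid m)" if "sid \<notin> S"
      using that plain \<open>Tr _ \<and> (_ \<longrightarrow> H _)\<close> \<open>sid \<in> S \<longleftrightarrow> _\<close> unfolding m H_def inst_def
      by (intro harmless_tag) blast+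
    ultimately show ?thesis using Tr by blast
  qed
qed

lemma K_snoc:
  "K (tr @ [(e, sid)]) = K tr \<union> (case e of Snd m \<Rightarrow> {m} | _ \<Rightarrow> {})"
  by (cases e) (auto simp: K_def)

text \<open>Induction on the trace: messages received so far are deducible by validity, hence
  harmless; \<open>sent_message\<close> transfers this to the next send;
  \<open>deduce_harmless\<close> then closes the enlarged knowledge under the attacker's
  rules.\<close>

lemma run_harmless:
  assumes "consistent sc" and "valid sg \<epsilon> Ne T0 (R \<sigma> sc)"
    and "deduce sg \<epsilon> Ne (T0 \<union> K (R \<sigma> sc)) t"
  shows "harmless \<epsilon> N \<tau> (D (R \<sigma> sc)) t"
  using assms
proof (induction sc arbitrary: t rule: rev_induct)
  case Nil
  show ?case
    unfolding D_def
    by (rule deduce_harmless[OF Nil(3)])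
      (use T0 in \<open>auto simp: K_def intro!: harmless_ground_atom\<close>)
next
  case (snoc x sc)
  obtain r sid where x: "x = (r, sid)" by (cases x)
  let ?e = "map_event (I r sid) id (events (P r) ! count_list (map snd sc) sid)"
  have run: "R \<sigma> (sc @ [x]) = R \<sigma> sc @ [(?e, sid)]"
    by (simp only: x run_snoc)
  note sc = consistent_snoc[OF snoc.prems(1)[unfolded x]]
  have valid: "valid sg \<epsilon> Ne T0 (R \<sigma> sc)"
    using snoc.prems(2) unfolding run valid_snoc by blast
  have mono: "D (R \<sigma> sc) \<subseteq> D (R \<sigma> (sc @ [x]))"
    unfolding run by (rule D_mono) auto
  have old: "harmless \<epsilon> N \<tau> (D (R \<sigma> (sc @ [x]))) u" if "deduce sg \<epsilon> Ne (T0 \<union> K (R \<sigma> sc)) u" for u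
    using harmless_mono[OF snoc.IH[OF sc(1) valid that] mono] .
  have new: "harmless \<epsilon> N \<tau> (D (R \<sigma> (sc @ [x]))) m" if m: "?e = Snd m" for m
  proof -
    from m obtain m' where m': "events (P r) ! count_list (map snd sc) sid = Snd m'" "m = I r sid m'"
      by (cases "events (P r) ! count_list (map snd sc) sid") auto
    have "transparent \<epsilon> N \<tau> (D (R \<sigma> (sc @ [x]))) m \<and>
        (sid \<notin> S \<longrightarrow> harmless \<epsilon> N \<tau> (D (R \<sigma> (sc @ [x]))) m)"
      unfolding D_def m'(2)
    proof (rule sent_message[OF snoc.prems(1)[unfolded x] m'(1)])
      fix m'' assume "(Rcv m'', sid) \<in> set (R \<sigma> sc)"
      then show "harmless \<epsilon> N \<tau> (derivable sg \<epsilon> Ne (T0 \<union> K (restrict (R \<sigma> (sc @ [x]))))) m''"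
        using old[unfolded D_def] valid_Rcv[OF valid] by blast
    qed
    moreover have "\<rho> m \<in> D (R \<sigma> (sc @ [x]))" if "sid \<in> S"
    proof -
      have "(Snd (\<rho> m), sid) \<in> set (restrict (R \<sigma> (sc @ [x])))"
        using that unfolding run restrict_def m by simp
      then show ?thesis
        by (auto simp: D_def derivable_def K_def intro: deduce.known)
    qed
    ultimately show ?thesis by (auto simp: harmless_def)
  qed
  show ?case
    unfolding D_def
  proof (rule deduce_harmless[OF snoc.prems(3)])
    fix u assume "u \<in> T0 \<union> K (R \<sigma> (sc @ [x]))"
    then consider "u \<in> T0 \<union> K (R \<sigma> sc)" | "?e = Snd u"
      unfolding run K_snoc by (auto split: event.splits)
    then show "harmless \<epsilon> N \<tau> (derivable sg \<epsilon> Ne (T0 \<union> K (restrict (R \<sigma> (sc @ [x]))))) u"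
      using old[unfolded D_def] new[unfolded D_def] deduce.known by metis
  qed
qed

lemma deduce_restrict:
  assumes "consistent sc" and "valid sg \<epsilon> Ne T0 (R \<sigma> sc)"
    and "deduce sg \<epsilon> Ne (T0 \<union> K (R \<sigma> sc)) t"
  shows "deduce sg \<epsilon> Ne (T0 \<union> K (restrict (R \<sigma> sc))) (\<rho> t)"
  using run_harmless[OF assms] by (simp add: harmless_def D_def derivable_def)

text \<open>Each kept receive is justified by applying \<open>deduce_restrict\<close> to the prefix
  before it.\<close>

lemma valid_restrict:
  assumes "consistent sc" and "valid sg \<epsilon> Ne T0 (R \<sigma> sc)"
  shows "valid sg \<epsilon> Ne T0 (restrict (R \<sigma> sc))"
  using assms
proof (induction sc rule: rev_induct)
  case (snoc x sc)
  obtain r sid where x: "x = (r, sid)" by (cases x)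
  obtain e where run: "R \<sigma> (sc @ [x]) = R \<sigma> sc @ [(e, sid)]"
    unfolding x run_snoc by blast
  note sc = consistent_snoc[OF snoc.prems(1)[unfolded x]]
  have valid: "valid sg \<epsilon> Ne T0 (R \<sigma> sc)"
    and rcv: "\<And>m. e = Rcv m \<Longrightarrow> deduce sg \<epsilon> Ne (T0 \<union> K (R \<sigma> sc)) m"
    using snoc.prems(2) unfolding run valid_snoc by simp_all
  have restrict: "restrict (R \<sigma> sc @ [(e, sid)]) =
      restrict (R \<sigma> sc) @ (if sid \<in> S then [(map_event \<rho> id e, sid)] else [])"
    by (simp add: restrict_def)
  have "deduce sg \<epsilon> Ne (T0 \<union> K (restrict (R \<sigma> sc))) m" if "map_event \<rho> id e = Rcv m" for m
    using that rcv deduce_restrict[OF sc(1) valid] by (cases e) auto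
  then show ?case
    using snoc.IH[OF sc(1) valid] unfolding run restrict by (auto simp: valid_snoc)
qed (simp add: restrict_def valid_def)

section \<open>Consequences of equal tags\<close>

lemma same_tag_part:
  assumes "sid \<in> S" and "sid' \<in> S" and "i \<in> {1..k}"
  shows "\<alpha> sid ! (i - 1) = \<alpha> sid' ! (i - 1)"
    and "I (rl sid) sid (Var (z i (rl sid))) = I (rl sid') sid' (Var (z i (rl sid')))"
proof -
  have r: "rl sid \<in> {1..k}" "rl sid' \<in> {1..k}"
    and "I (rl sid) sid (role_tag k z Q (rl sid)) = I (rl sid') sid' (role_tag k z Q (rl sid'))"
    using assms by (simp_all add: S_def)
  then have "map (\<lambda>i. I (rl sid) sid (tag_part z Q (rl sid) i)) [1..<Suc k] =
      map (\<lambda>i. I (rl sid') sid' (tag_part z Q (rl sid') i)) [1..<Suc k]"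
    by (intro tuple_inject) (simp_all add: inst_role_tag del: upt_Suc)
  then have "I (rl sid) sid (tag_part z Q (rl sid) i) = I (rl sid') sid' (tag_part z Q (rl sid') i)"
    using assms(3) by (simp del: upt_Suc)
  then show "\<alpha> sid ! (i - 1) = \<alpha> sid' ! (i - 1)"
    "I (rl sid) sid (Var (z i (rl sid))) = I (rl sid') sid' (Var (z i (rl sid')))"
    using inst_tag_part assms(3) r by simp_all
qed

lemma same_agents:
  assumes "sid \<in> S" and "sid' \<in> S"
  shows "\<alpha> sid = \<alpha> sid'"
proof (rule nth_equalityI)
  fix i assume "i < length (\<alpha> sid)"
  then show "\<alpha> sid ! i = \<alpha> sid' ! i"
    using same_tag_part(1)[OF assms, of "Suc i"] length_\<alpha> by simp
qed (simp add: length_\<alpha>)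

lemma one_session:
  assumes "sid \<in> S" and "sid' \<in> S" and "rl sid = rl sid'"
  shows "sid = sid'"
proof -
  let ?r = "rl sid"
  have r: "?r \<in> {1..k}" using assms(1) by (simp add: S_def)
  then have "nonce (z ?r ?r) sid = nonce (z ?r ?r) sid'"
    using same_tag_part(2)[OF assms(1,2) r] assms(3) by (simp add: inst_def)
  moreover have "z ?r ?r \<in> protocol_nonces k P"
    using r by (auto simp: protocol_nonces_def)
  ultimately have "(z ?r ?r, sid) = (z ?r ?r, sid')"
    using fresh unfolding fresh_nonces_def
    by (intro inj_onD[of "\<lambda>(y, sid). nonce y sid"]) auto
  then show ?thesis by simp
qed

end

section \<open>From annotated protocols to the locale\<close>

text \<open>The common shape of the three annotations: status events around an unchanged body.
  Variables in their arguments are unrestricted, so that the nonce in \<open>Secret\<close> is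
  allowed.\<close>

definition annotates :: "nat \<Rightarrow> ('a, 'x, 'y, 'n, 'p) protocol \<Rightarrow> ('a, 'x, 'y, 'n, 'p) protocol \<Rightarrow> bool" where
  "annotates k \<Pi> Q \<longleftrightarrow> (\<forall>r\<in>{1..k}. params (Q r) = params (\<Pi> r) \<and> nonces (Q r) = nonces (\<Pi> r) \<and>
     (\<exists>pre post. events (Q r) = pre @ events (\<Pi> r) @ post \<and>
        (\<forall>e\<in>set pre \<union> set post. \<exists>p ts. e = Status p ts \<and>
           (\<forall>t\<in>set ts. names t = {} \<and> avars t \<subseteq> set (params (\<Pi> r))))))"

text \<open>A send cannot lie in \<open>pre\<close> or \<open>post\<close>, so the condition on
  \<open>R\<close> applies after a shift by \<open>length pre\<close>.\<close>

lemma origination_annotates: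
  assumes "wf_role k R" and "es = pre @ events R @ post"
    and "\<And>e. e \<in> set pre \<union> set post \<Longrightarrow> \<exists>p ts. e = Status p ts"
    and "i < length es" and "es ! i = Snd m" and "Var y \<in> plaintext m" and "y \<notin> set (nonces R)"
  shows "\<exists>j<i. \<exists>m'. es ! j = Rcv m' \<and> Var y \<in> plaintext m'"
proof -
  have "es ! i \<notin> set pre \<union> set post"
    using assms(3)[of "es ! i"] assms(5) by auto
  then have "es ! i \<notin> set pre" "es ! i \<notin> set post" by simp_all
  have i: "length pre \<le> i"
    using \<open>es ! i \<notin> set pre\<close> assms(2) by (metis leI nth_append_left nth_mem)
  then have nth: "es ! i = (events R @ post) ! (i - length pre)"
    using assms(2) by (simp add: nth_append)
  have "i - length pre < length (events R)"
  proof (rule ccontr)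
    assume "\<not> ?thesis"
    moreover from this have "i - length pre - length (events R) < length post"
      using i assms(2,4) by simp
    ultimately show False
      using nth \<open>es ! i \<notin> set post\<close> by (simp add: nth_append)
  qed
  note i = i this
  have "es ! i = events R ! (i - length pre)"
    using nth i by (simp add: nth_append)
  with assms(5) have snd: "events R ! (i - length pre) = Snd m" by simp
  then obtain j where j: "j < i - length pre" "is_rcv (events R ! j)" "Var y \<in> ev_plaintext (events R ! j)"
  proof -
    have "Var y \<in> ev_plaintext (events R ! (i - length pre))" "\<not> is_rcv (events R ! (i - length pre))"
      using snd assms(6) by (simp_all add: ev_plaintext_def)
    with assms(1,7) i(2) that show thesis unfolding wf_role_def by blast
  qed
  then obtain m' where "events R ! j = Rcv m'" "Var y \<in> plaintext m'"
    by (cases "events R ! j") (auto simp: ev_plaintext_def)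
  moreover have "es ! (length pre + j) = events R ! j"
    using j(1) i assms(2) by (simp add: nth_append)
  ultimately show ?thesis
    using j(1) by (intro exI[of _ "length pre + j"]) auto
qed

lemma lgKeys_plaintext:
  assumes "t \<in> plaintext m" and "t \<in> range Priv \<union> range Shk"
  shows "t \<in> lgKeys m"
proof -
  have "t \<in> St m"
    using assms by (induction m) auto
  with assms(2) show ?thesis by (auto simp: lgKeys_def)
qed

text \<open>Leaves the locale and hides \<open>purge\<close> behind the few properties of \<rho>
  that the attack formulas need. Deducibility and the kept nonces serve secrecy; the reflection of
  agents other than \<epsilon> serves the negated \<open>Start\<close> conditions.\<close>

lemma one_tag_reduction:
  fixes \<Pi> Q :: "('a, 'x, 'y, 'n, 'p) protocol"
  assumes \<Pi>: "is_protocol k \<Pi>" and Q: "annotates k \<Pi> Q"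
    and fresh: "fresh_nonces Ne k (transform k z \<Pi>) nonce"
    and T0: "T0 \<subseteq> ground_atoms"
    and keys: "protocol_lgKeys k \<Pi> \<inter> protocol_plaintext k \<Pi> \<subseteq> T0 \<union> eps_keys \<epsilon>"
    and exec: "is_exec nonce k (transform k z Q) sc \<alpha> exec" and valid: "valid sg \<epsilon> Ne T0 exec"
    and sid0: "sid0 \<in> snd ` set exec" and honest: "honest sg \<epsilon> Ne T0 \<alpha> sid0"
  obtains exec' \<rho> S sc' where
    "exec' = map (\<lambda>(e, sid). (map_event \<rho> id e, sid)) (filter (\<lambda>x. snd x \<in> S) exec)"
    and "sid0 \<in> S"
    and "is_exec nonce k (transform k z Q) sc' \<alpha> exec'" and "valid sg \<epsilon> Ne T0 exec'"
    and "\<forall>sid\<in>snd ` set exec'. honest sg \<epsilon> Ne T0 \<alpha> sid" and "one_session_per_role sc'"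
    and "\<And>t. deduce sg \<epsilon> Ne (T0 \<union> K exec) t \<Longrightarrow> deduce sg \<epsilon> Ne (T0 \<union> K exec') (\<rho> t)"
    and "\<And>a. \<rho> (Atm (Agt a)) = Atm (Agt a)"
    and "\<And>a t. a \<noteq> \<epsilon> \<Longrightarrow> \<rho> t = Atm (Agt a) \<Longrightarrow> t = Atm (Agt a)"
    and "\<And>r y. (r, sid0) \<in> set sc \<Longrightarrow> y \<in> set (nonces (Q r)) \<Longrightarrow>
      \<rho> (Name (nonce y sid0)) = Name (nonce y sid0)"
proof -
  let ?P = "transform k z Q"
  obtain \<sigma> where sc: "is_scenario k ?P sc" and len: "\<And>sid. length (\<alpha> sid) = k"
    and ground: "\<forall>(e, sid)\<in>set (symbolic_trace nonce ?P sc \<alpha>). \<forall>v\<in>ev_vars e. ground (\<sigma> v)"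
    and exec_eq: "exec = run nonce ?P \<alpha> \<sigma> sc"
    using exec unfolding is_exec_iff by blast
  \<comment> \<open>A total choice of roles; the scenario makes it the actual role of every session
    that occurs.\<close>
  define rl where "rl sid = (SOME r. (r, sid) \<in> set sc)" for sid
  have rl: "r = rl sid" if "(r, sid) \<in> set sc" for r sid
  proof -
    have "(rl sid, sid) \<in> set sc"
      unfolding rl_def using that by (rule someI)
    with that sc show ?thesis unfolding is_scenario_iff by fastforce
  qed
  have wf: "wf_role k (\<Pi> r)" if "r \<in> {1..k}" for r
    using \<Pi> that unfolding is_protocol_def by blast
  note Qr = Q[unfolded annotates_def, rule_format]
  have Q_terms: "names t = {} \<and> avars t \<subseteq> set (params (Q r))"
    if r: "r \<in> {1..k}" and t: "t \<in> role_terms (Q r)" for r t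
  proof -
    from Qr[OF r] obtain pre post where ev: "events (Q r) = pre @ events (\<Pi> r) @ post"
      and pp: "\<forall>e\<in>set pre \<union> set post. \<exists>p ts. e = Status p ts \<and>
           (\<forall>t\<in>set ts. names t = {} \<and> avars t \<subseteq> set (params (\<Pi> r)))"
      and params: "params (Q r) = params (\<Pi> r)" by blast
    from t obtain e where e: "e \<in> set (events (Q r))" "t \<in> terms_in e"
      unfolding role_terms_def by blast
    then consider "e \<in> set pre \<union> set post" | "e \<in> set (events (\<Pi> r))" unfolding ev by auto
    then show ?thesis
    proof cases
      case 1
      with pp obtain p ts where "e = Status p ts"
        "\<forall>t\<in>set ts. names t = {} \<and> avars t \<subseteq> set (params (\<Pi> r))" by blast
      with e(2) params show ?thesis by simp
    next
      case 2
      with e(2) wf[OF r] params show ?thesis by (auto simp: wf_role_def role_terms_def)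
    qed
  qed
  have Q_snd: "Snd p \<in> set (events (\<Pi> r))" if "r \<in> {1..k}" "Snd p \<in> set (events (Q r))" for r p
    using Qr[OF that(1)] that(2) by fastforce
  define \<tau> where "\<tau> = inst nonce ?P \<alpha> \<sigma> (rl sid0) sid0 (role_tag k z Q (rl sid0))"
  interpret tagged_run sg \<epsilon> Ne nonce k Q z T0 \<alpha> \<sigma> rl \<tau>
  proof
    fix r assume r: "r \<in> {1..k}"
    show "distinct (params (Q r))" "length (params (Q r)) = k"
      using wf[OF r] Qr[OF r] by (auto simp: wf_role_def)
    show "names t = {}" "avars t \<subseteq> set (params (Q r))" if "t \<in> role_terms (Q r)" for t
      using Q_terms[OF r that] by blast+
    show "\<exists>j<i. \<exists>p'. events (Q r) ! j = Rcv p' \<and> Var y \<in> plaintext p'"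
      if "i < length (events (Q r))" "events (Q r) ! i = Snd p" "Var y \<in> plaintext p"
        "y \<notin> set (nonces (Q r))" for i p y
    proof -
      from Qr[OF r] obtain pre post where ev: "events (Q r) = pre @ events (\<Pi> r) @ post"
        and pp: "\<forall>e\<in>set pre \<union> set post. \<exists>p ts. e = Status p ts \<and>
           (\<forall>t\<in>set ts. names t = {} \<and> avars t \<subseteq> set (params (\<Pi> r)))"
        and "nonces (Q r) = nonces (\<Pi> r)" by blast
      with that(4) show ?thesis
        by (intro origination_annotates[OF wf[OF r] ev _ that(1,2,3)]) (blast, simp)
    qed
    show "t \<in> T0 \<union> eps_keys \<epsilon>" if p: "Snd p \<in> set (events (Q r))" and "t \<in> plaintext p"
      "t \<in> range Priv \<union> range Shk" for p t
    proof -
      have "p \<in> protocol_terms k \<Pi>"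
        using Q_snd[OF r p] r by (force simp: protocol_terms_def role_terms_def)
      then have "t \<in> protocol_lgKeys k \<Pi> \<inter> protocol_plaintext k \<Pi>"
        using that lgKeys_plaintext unfolding protocol_lgKeys_def protocol_plaintext_def by blast
      with keys show ?thesis by blast
    qed
  next
    have "protocol_nonces k ?P = protocol_nonces k (transform k z \<Pi>)"
      using Qr by (simp add: protocol_nonces_def)
    with fresh show "fresh_nonces Ne k ?P nonce"
      by (simp add: fresh_nonces_def)
  qed (use T0 len in auto)
  have cons: "consistent sc"
    using sc rl by (auto simp: consistent_def)
  define sc' where "sc' = filter (\<lambda>x. snd x \<in> S) sc"
  define exec' where "exec' = restrict exec"
  have exec': "exec' = run nonce P \<alpha> (\<rho> \<circ> \<sigma>) sc'"
    using run_purge[OF cons] by (simp only: sc'_def exec'_def exec_eq)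
  have in_sc: "\<exists>r. (r, sid) \<in> set sc \<and> r \<in> {1..k}" if "sid \<in> snd ` set exec" for sid
  proof -
    from that obtain e where "(e, sid) \<in> set (run nonce P \<alpha> \<sigma> sc)"
      unfolding exec_eq by auto
    then show ?thesis by (rule run_event_origin[OF sc]) blast
  qed
  from in_sc[OF sid0] have "rl sid0 \<in> {1..k}" using rl by blast
  moreover have "I (rl sid0) sid0 (role_tag k z Q (rl sid0)) = \<tau>" by (simp only: \<tau>_def)
  ultimately have S0: "sid0 \<in> S" unfolding S_def by blast
  show thesis
  proof (rule that)
    show "exec' = map (\<lambda>(e, sid). (map_event \<rho> id e, sid)) (filter (\<lambda>x. snd x \<in> S) exec)"
      by (simp add: exec'_def restrict_def)
    show "sid0 \<in> S" by (fact S0)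
    show "is_exec nonce k P sc' \<alpha> exec'"
      unfolding is_exec_iff
    proof (intro conjI exI)
      have "count_list sc' x = count_list sc x" if "x \<in> set sc'" for x
        using that unfolding sc'_def by (intro count_list_filter) simp
      then show "is_scenario k P sc'"
        using sc unfolding is_scenario_iff by (simp add: sc'_def)
      show "\<forall>sid. length (\<alpha> sid) = k" using len by blast
      show "\<forall>(e, sid)\<in>set (symbolic_trace nonce P sc' \<alpha>). \<forall>v\<in>ev_vars e. ground ((\<rho> \<circ> \<sigma>) v)"
        using ground unfolding sc'_def symbolic_trace_filter
        by (fastforce intro: ground_purge)
      show "exec' = run nonce P \<alpha> (\<rho> \<circ> \<sigma>) sc'" by (fact exec')
    qed
    show "valid sg \<epsilon> Ne T0 exec'"
      using valid_restrict[OF cons] valid unfolding exec'_def exec_eq by blast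
    show "\<forall>sid\<in>snd ` set exec'. honest sg \<epsilon> Ne T0 \<alpha> sid"
      using same_agents[OF S0] honest by (auto simp: exec'_def restrict_def honest_def)
    show "one_session_per_role sc'"
      using one_session rl unfolding one_session_per_role_def sc'_def by auto
    show "deduce sg \<epsilon> Ne (T0 \<union> K exec') (\<rho> t)" if "deduce sg \<epsilon> Ne (T0 \<union> K exec) t" for t
      using deduce_restrict[OF cons] valid that unfolding exec'_def exec_eq by blast
    show "\<rho> (Atm (Agt a)) = Atm (Agt a)" for a by simp
    show "a \<noteq> \<epsilon> \<Longrightarrow> \<rho> t = Atm (Agt a) \<Longrightarrow> t = Atm (Agt a)" for a t by (rule purge_eq_agent)
    show "\<rho> (Name (nonce y sid0)) = Name (nonce y sid0)"
      if "(r, sid0) \<in> set sc" "y \<in> set (nonces (Q r))" for r y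
      using that rl S0 by (auto simp: N_def)
  qed
qed

section \<open>Attack formulas\<close>

lemma subst_atm_agt: "(\<And>x. \<theta> x \<in> range Atm) \<Longrightarrow> subst_atm \<theta> u = Atm (subst_agt \<theta> u)"
proof (cases u)
  case (AVar x)
  moreover assume "\<And>x. \<theta> x \<in> range Atm"
  then obtain w where "\<theta> x = Atm w" by blast
  ultimately show ?thesis by simp
qed simp

lemma sat_Conj [simp]: "sat sg \<epsilon> Ne T0 exec (Conj \<phi>s) \<longleftrightarrow> (\<forall>\<phi>\<in>set \<phi>s. sat sg \<epsilon> Ne T0 exec \<phi>)"
  by (induction \<phi>s) (auto simp: Conj_def)

lemma sat_Disj [simp]: "sat sg \<epsilon> Ne T0 exec (Disj \<phi>s) \<longleftrightarrow> (\<exists>\<phi>\<in>set \<phi>s. sat sg \<epsilon> Ne T0 exec \<phi>)"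
  by (induction \<phi>s) (auto simp: Disj_def)

lemma subst_form_Conj [simp]:
  "subst_form (Conj \<phi>s) \<theta> \<sigma> = Conj (map (\<lambda>\<phi>. subst_form \<phi> \<theta> \<sigma>) \<phi>s)"
  by (induction \<phi>s) (auto simp: Conj_def)

lemma subst_form_Disj [simp]:
  "subst_form (Disj \<phi>s) \<theta> \<sigma> = Disj (map (\<lambda>\<phi>. subst_form \<phi> \<theta> \<sigma>) \<phi>s)"
  by (induction \<phi>s) (auto simp: Disj_def)

lemma key_avars_form_Conj [simp]: "key_avars_form (Conj \<phi>s) = (\<Union>\<phi>\<in>set \<phi>s. key_avars_form \<phi>)"
  by (induction \<phi>s) (auto simp: Conj_def)

lemma key_avars_form_foldr_ExA [simp]:
  "key_avars_form (foldr ExA xs \<phi>) = key_avars_form \<phi> - set xs"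
  by (induction xs) auto

lemma subst_form_foldr_ExA:
  "subst_form (foldr ExA xs \<phi>) \<theta> \<sigma> =
     foldr ExA xs (subst_form \<phi> (\<lambda>x. if x \<in> set xs then Atm (AVar x) else \<theta> x) \<sigma>)"
proof (induction xs arbitrary: \<theta>)
  case (Cons x xs)
  have "(\<lambda>v. if v \<in> set xs then Atm (AVar v) else (\<theta>(x := Atm (AVar x))) v) =
      (\<lambda>v. if v \<in> set (x # xs) then Atm (AVar v) else \<theta> v)"
    by auto
  with Cons show ?case by simp
qed simp

text \<open>
  Every quantified variable occurs below \<^const>\<open>Comp\<close>, hence ranges over agents only.
\<close>

lemma sat_foldr_ExA:
  fixes B :: "('a, 'x) agt list \<Rightarrow> ('a, 'x, 'y, 'n, 'p) form"
  assumes subst: "\<And>us \<theta>. length us = n \<Longrightarrow> (\<And>x. \<theta> x \<in> range Atm) \<Longrightarrow>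
      subst_form (B us) \<theta> Var = B (map (subst_agt \<theta>) us)"
    and keys: "\<And>us u. length us = n \<Longrightarrow> u \<in> set us \<Longrightarrow> agt_avars u \<subseteq> key_avars_form (B us)"
  shows "distinct xs \<Longrightarrow> length bs + length xs = n \<Longrightarrow>
    sat sg \<epsilon> Ne T0 exec (foldr ExA xs (B (map Agt bs @ map AVar xs))) \<longleftrightarrow>
    (\<exists>as. length as = length xs \<and> sat sg \<epsilon> Ne T0 exec (B (map Agt (bs @ as))))"
proof (induction xs arbitrary: bs)
  case (Cons x xs)
  let ?us = "map Agt bs @ map AVar (x # xs)"
  let ?\<phi> = "foldr ExA xs (B ?us)"
  have "x \<in> key_avars_form ?\<phi>"
    using keys[of ?us "AVar x"] Cons.prems by auto
  moreover have "ground (Atm (Agt a) :: ('a, 'x, 'y, 'n) msg)" for a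
    by (simp add: ground_def)
  ultimately have "sat sg \<epsilon> Ne T0 exec (ExA x ?\<phi>) \<longleftrightarrow>
      (\<exists>a. sat sg \<epsilon> Ne T0 exec (inst_avar x (Atm (Agt a)) ?\<phi>))"
    by auto
  also have "\<dots> \<longleftrightarrow> (\<exists>a. sat sg \<epsilon> Ne T0 exec
      (foldr ExA xs (B (map Agt (bs @ [a]) @ map AVar xs))))"
  proof -
    have "inst_avar x (Atm (Agt a)) ?\<phi> = foldr ExA xs (B (map Agt (bs @ [a]) @ map AVar xs))" for a
    proof -
      define \<theta> :: "'x \<Rightarrow> ('a, 'x, 'y, 'n) msg"
        where "\<theta> = (\<lambda>v. if v \<in> set xs then Atm (AVar v)
          else ((\<lambda>x. Atm (AVar x))(x := Atm (Agt a))) v)"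
      \<comment> \<open>By distinctness x is not bound again by the inner quantifiers, so the
        instantiation changes exactly its entry in the list.\<close>
      have us: "map (subst_agt \<theta>) ?us = map Agt (bs @ [a]) @ map AVar xs"
        using Cons.prems(1) by (auto simp: \<theta>_def)
      have B: "subst_form (B ?us) \<theta> Var = B (map (subst_agt \<theta>) ?us)"
        using Cons.prems(2) by (intro subst) (auto simp: \<theta>_def)
      show ?thesis
        unfolding inst_avar_def subst_form_foldr_ExA \<theta>_def[symmetric] B us ..
    qed
    then show ?thesis by simp
  qed
  also have "\<dots> \<longleftrightarrow> (\<exists>a as. length as = length xs \<and>
      sat sg \<epsilon> Ne T0 exec (B (map Agt ((bs @ [a]) @ as))))"
    using Cons.prems by (subst Cons.IH) auto
  also have "\<dots> \<longleftrightarrow> (\<exists>as. length as = length (x # xs) \<and> sat sg \<epsilon> Ne T0 exec (B (map Agt (bs @ as))))"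
  proof -
    have "(\<exists>a as. length as = m \<and> p (a # as)) \<longleftrightarrow> (\<exists>as. length as = Suc m \<and> p as)"
      for m and p :: "'a list \<Rightarrow> bool"
      by (metis length_Cons length_Suc_conv)
    from this[of "length xs" "\<lambda>as. sat sg \<epsilon> Ne T0 exec (B (map Agt (bs @ as)))"]
    show ?thesis by simp
  qed
  finally show ?case by simp
qed simp

lemma sat_Once_SPred:
  "sat sg \<epsilon> Ne T0 exec (Once (SPred p ts)) \<longleftrightarrow> (\<exists>sid. (Status p ts, sid) \<in> set exec)"
proof
  assume "sat sg \<epsilon> Ne T0 exec (Once (SPred p ts))"
  then obtain i where "take i exec \<noteq> []" "fst (last (take i exec)) = Status p ts" by auto
  then have "(Status p ts, snd (last (take i exec))) \<in> set exec"
    by (metis in_set_takeD last_in_set prod.collapse)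
  then show "\<exists>sid. (Status p ts, sid) \<in> set exec" ..
next
  assume "\<exists>sid. (Status p ts, sid) \<in> set exec"
  then obtain sid i where "i < length exec" "exec ! i = (Status p ts, sid)"
    by (auto simp: in_set_conv_nth)
  then have "ssat (take (Suc i) exec) (SPred p ts)" "Suc i \<le> length exec"
    by (simp_all add: take_Suc_conv_app_nth)
  then show "sat sg \<epsilon> Ne T0 exec (Once (SPred p ts))" unfolding sat.simps by blast
qed

abbreviation uncompromised :: "bool \<Rightarrow> 'a \<Rightarrow> 'n set \<Rightarrow> ('a, 'x, 'y, 'n) msg set \<Rightarrow> 'a list \<Rightarrow> bool" where
  "uncompromised sg \<epsilon> Ne T0 as \<equiv> \<forall>a\<in>set as. \<not> compromised sg \<epsilon> Ne T0 (Agt a)"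

lemma sat_attack_secrecy:
  fixes xs :: "'x list" and y :: 'y and exec :: "('a, 'x, 'y, 'n, 'p) trace"
  assumes "distinct xs"
  shows "sat sg \<epsilon> Ne T0 exec (attack_secrecy xs y) \<longleftrightarrow>
    (\<exists>as t sid. length as = length xs \<and> ground t \<and> uncompromised sg \<epsilon> Ne T0 as \<and>
       (Status Secret (map (\<lambda>a. Atm (Agt a)) as @ [t]), sid) \<in> set exec \<and>
       deduce sg \<epsilon> Ne (T0 \<union> K exec) t)"
proof -
  \<comment> \<open>The matrix as a function of the list of agents, the form that
    \<open>sat_foldr_ExA\<close> works on.\<close>
  define B :: "('a, 'x) agt list \<Rightarrow> ('a, 'x, 'y, 'n, 'p) form" where
    "B us = ExV y (Conj (Once (SPred Secret (map Atm us @ [Var y])) # map NC us @ [Learn (Var y)]))" for us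
  have "sat sg \<epsilon> Ne T0 exec (foldr ExA xs (B (map Agt [] @ map AVar xs))) \<longleftrightarrow>
    (\<exists>as. length as = length xs \<and> sat sg \<epsilon> Ne T0 exec (B (map Agt ([] @ as))))"
    by (rule sat_foldr_ExA[where n = "length xs"])
      (auto simp: B_def subst_atm_agt comp_def fun_upd_idem assms)
  moreover have "sat sg \<epsilon> Ne T0 exec (B (map Agt as)) \<longleftrightarrow>
    (\<exists>t sid. ground t \<and> uncompromised sg \<epsilon> Ne T0 as \<and>
       (Status Secret (map (\<lambda>a. Atm (Agt a)) as @ [t]), sid) \<in> set exec \<and>
       deduce sg \<epsilon> Ne (T0 \<union> K exec) t)" for as
    by (auto simp: B_def inst_var_def comp_def sat_Once_SPred simp del: sat.simps(7))
  ultimately show ?thesis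
    by (simp add: attack_secrecy_def B_def comp_def)
qed

lemma sat_attack_aliveness:
  fixes xs :: "'x list" and exec :: "('a, 'x, 'y, 'n, 'p) trace"
  assumes "distinct xs"
  shows "sat sg \<epsilon> Ne T0 exec (attack_aliveness xs) \<longleftrightarrow>
    (\<exists>as. length as = length xs \<and> uncompromised sg \<epsilon> Ne T0 as \<and>
       exec \<noteq> [] \<and> fst (last exec) = Status End (map (\<lambda>a. Atm (Agt a)) as) \<and>
       (\<exists>a\<in>set as. \<forall>sid. (Status Start [Atm (Agt a)], sid) \<notin> set exec))"
proof -
  define B :: "('a, 'x) agt list \<Rightarrow> ('a, 'x, 'y, 'n, 'p) form" where
    "B us = Conj (State (SPred End (map Atm us)) # map NC us
      @ [Disj (map (\<lambda>u. Neg (Once (SPred Start [Atm u]))) us)])" for us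
  have "sat sg \<epsilon> Ne T0 exec (foldr ExA xs (B (map Agt [] @ map AVar xs))) \<longleftrightarrow>
    (\<exists>as. length as = length xs \<and> sat sg \<epsilon> Ne T0 exec (B (map Agt ([] @ as))))"
    by (rule sat_foldr_ExA[where n = "length xs"])
      (auto simp: B_def subst_atm_agt comp_def assms)
  moreover have "sat sg \<epsilon> Ne T0 exec (B (map Agt as)) \<longleftrightarrow>
    uncompromised sg \<epsilon> Ne T0 as \<and>
       exec \<noteq> [] \<and> fst (last exec) = Status End (map (\<lambda>a. Atm (Agt a)) as) \<and>
       (\<exists>a\<in>set as. \<forall>sid. (Status Start [Atm (Agt a)], sid) \<notin> set exec)" for as
    by (auto simp: B_def comp_def sat_Once_SPred simp del: sat.simps(7))
  ultimately show ?thesis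
    by (simp add: attack_aliveness_def B_def comp_def)
qed

lemma sat_attack_weak_agreement:
  fixes xs :: "'x list" and exec :: "('a, 'x, 'y, 'n, 'p) trace"
  assumes "distinct xs" and "i \<in> {1..length xs}" and "j \<in> {1..length xs}"
  shows "sat sg \<epsilon> Ne T0 exec (attack_weak_agreement i j xs) \<longleftrightarrow>
    (\<exists>as. length as = length xs \<and> uncompromised sg \<epsilon> Ne T0 as \<and>
       exec \<noteq> [] \<and> fst (last exec) = Status (EndRole j) (map (\<lambda>a. Atm (Agt a)) as) \<and>
       (\<forall>sid. (Status Start [Atm (Agt (as ! (i - 1))), Atm (Agt (as ! (j - 1)))], sid) \<notin> set exec))"
proof -
  define B :: "('a, 'x) agt list \<Rightarrow> ('a, 'x, 'y, 'n, 'p) form" where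
    "B us = Conj (State (SPred (EndRole j) (map Atm us)) # map NC us
      @ [Neg (Once (SPred Start [Atm (us ! (i - 1)), Atm (us ! (j - 1))]))])" for us
  have ij: "i - 1 < length xs" "j - 1 < length xs" using assms by auto
  have "sat sg \<epsilon> Ne T0 exec (foldr ExA xs (B (map Agt [] @ map AVar xs))) \<longleftrightarrow>
    (\<exists>as. length as = length xs \<and> sat sg \<epsilon> Ne T0 exec (B (map Agt ([] @ as))))"
    by (rule sat_foldr_ExA[where n = "length xs"])
      (use ij in \<open>auto simp: B_def subst_atm_agt comp_def assms(1)\<close>)
  moreover have "sat sg \<epsilon> Ne T0 exec (B (map Agt as)) \<longleftrightarrow>
    uncompromised sg \<epsilon> Ne T0 as \<and>
       exec \<noteq> [] \<and> fst (last exec) = Status (EndRole j) (map (\<lambda>a. Atm (Agt a)) as) \<and>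
       (\<forall>sid. (Status Start [Atm (Agt (as ! (i - 1))), Atm (Agt (as ! (j - 1)))], sid) \<notin> set exec)"
    if "length as = length xs" for as
    using ij that by (auto simp: B_def comp_def sat_Once_SPred simp del: sat.simps(7))
  ultimately show ?thesis
    using ij by (simp add: attack_weak_agreement_def B_def comp_def cong: conj_cong)
qed

text \<open>Separates the uncompromised agents from \<epsilon>, as the reflection of agents under
  purging requires.\<close>

lemma eps_compromised: "compromised sg \<epsilon> Ne T0 (Agt \<epsilon>)"
  by (auto simp: compromised_def eps_keys_def intro: deduce.eps_key)

section \<open>The annotated protocols\<close>

lemma annotatesI:
  assumes "\<And>r. r \<in> {1..k} \<Longrightarrow> params (Q r) = params (\<Pi> r)"
    and "\<And>r. r \<in> {1..k} \<Longrightarrow> nonces (Q r) = nonces (\<Pi> r)"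
    and "\<And>r. r \<in> {1..k} \<Longrightarrow> events (Q r) = pre r @ events (\<Pi> r) @ post r"
    and "\<And>r e. r \<in> {1..k} \<Longrightarrow> e \<in> set (pre r) \<union> set (post r) \<Longrightarrow> \<exists>p ts. e = Status p ts \<and>
      (\<forall>t\<in>set ts. names t = {} \<and> avars t \<subseteq> set (params (\<Pi> r)))"
  shows "annotates k \<Pi> Q"
  using assms unfolding annotates_def by blast

lemma annotates_secrecy: "annotates k \<Pi> (annot_secrecy j h \<Pi>)"
  by (rule annotatesI[where post = "\<lambda>_. []" and pre = "\<lambda>r. if r = j then
      [Status Secret (map AV (params (\<Pi> j)) @ [Var (nonces (\<Pi> j) ! (h - 1))])] else []"])
    (auto simp: annot_secrecy_def split: if_splits)

lemma own_param:
  assumes "is_protocol k \<Pi>" and "r \<in> {1..k}"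
  shows "params (\<Pi> r) ! (r - 1) \<in> set (params (\<Pi> r))"
  using assms by (intro nth_mem) (auto simp: is_protocol_def wf_role_def)

lemma annotates_aliveness:
  assumes "is_protocol k \<Pi>"
  shows "annotates k \<Pi> (annot_aliveness \<Pi>)"
  by (rule annotatesI[where pre = "\<lambda>r. [Status Start [AV (params (\<Pi> r) ! (r - 1))]]"
        and post = "\<lambda>r. [Status End (map AV (params (\<Pi> r)))]"])
    (use own_param[OF assms] in \<open>auto simp: annot_aliveness_def\<close>)

lemma annotates_weak_agreement:
  assumes "is_protocol k \<Pi>"
  shows "annotates k \<Pi> (annot_weak_agreement \<Pi>)"
  by (rule annotatesI[where
        pre = "\<lambda>r. map (\<lambda>x. Status Start [AV (params (\<Pi> r) ! (r - 1)), AV x]) (params (\<Pi> r))"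
        and post = "\<lambda>r. [Status (EndRole r) (map AV (params (\<Pi> r)))]"])
    (use own_param[OF assms] in \<open>auto simp: annot_weak_agreement_def\<close>)

lemma inst_params:
  assumes "distinct (params (P r))" and "length (params (P r)) = length (\<alpha> sid)"
  shows "map (inst nonce P \<alpha> \<sigma> r sid) (map AV (params (P r))) = map (\<lambda>a. Atm (Agt a)) (\<alpha> sid)"
proof (rule nth_equalityI)
  fix i assume "i < length (map (inst nonce P \<alpha> \<sigma> r sid) (map AV (params (P r))))"
  then have i: "i < length (\<alpha> sid)" using assms(2) by simp
  have "map_of (zip (params (P r)) (\<alpha> sid)) (params (P r) ! i) = Some (\<alpha> sid ! i)"
    using i assms by (intro map_of_zip_nth) auto
  then show "map (inst nonce P \<alpha> \<sigma> r sid) (map AV (params (P r))) ! i = map (\<lambda>a. Atm (Agt a)) (\<alpha> sid) ! i"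
    using i assms(2) by (simp add: inst_def param_subst_def)
qed (use assms in simp)

text \<open>\<open>vs\<close> gives the nonces listed after the parameters: at most one for
  \<open>Secret\<close>, none for the end events. Tagging leaves atoms and variables alone, so the
  arguments reveal the agents and nonces of the session, independently of \<sigma>.\<close>

lemma status_args:
  assumes \<Pi>: "is_protocol k \<Pi>" and Q: "annotates k \<Pi> Q"
    and exec: "is_exec nonce k (transform k z Q) sc \<alpha> exec"
    and e: "(Status p ts, sid) \<in> set exec"
    and args: "\<And>r us. r \<in> {1..k} \<Longrightarrow> Status p us \<in> set (events (Q r)) \<Longrightarrow>
      us = map AV (params (\<Pi> r)) @ map Var (vs r) \<and> set (vs r) \<subseteq> set (nonces (\<Pi> r))"
  obtains r where "(r, sid) \<in> set sc" and "r \<in> {1..k}" and "set (vs r) \<subseteq> set (nonces (\<Pi> r))"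
    and "ts = map (\<lambda>a. Atm (Agt a)) (\<alpha> sid) @ map (\<lambda>y. Name (nonce y sid)) (vs r)"
proof -
  let ?P = "transform k z Q"
  obtain \<sigma> where sc: "is_scenario k ?P sc" and len: "\<And>sid. length (\<alpha> sid) = k"
    and exec_eq: "exec = run nonce ?P \<alpha> \<sigma> sc"
    using exec unfolding is_exec_iff by blast
  obtain r e' where r: "(r, sid) \<in> set sc" "r \<in> {1..k}" and e': "e' \<in> set (events (?P r))"
    and eq: "Status p ts = map_event (inst nonce ?P \<alpha> \<sigma> r sid) id e'"
    using run_event_origin[OF sc e[unfolded exec_eq]] by blast
  obtain us' where us': "e' = Status p us'" "ts = map (inst nonce ?P \<alpha> \<sigma> r sid) us'"
    using eq by (cases e') auto
  obtain us where us: "Status p us \<in> set (events (Q r))" "us' = map (tag (role_tag k z Q r)) us"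
  proof -
    from e' us'(1) obtain e'' where "e'' \<in> set (events (Q r))"
      "Status p us' = map_event (tag (role_tag k z Q r)) id e''"
      by (auto simp: transform_def split: if_splits)
    moreover from this(2) obtain us where "e'' = Status p us" "us' = map (tag (role_tag k z Q r)) us"
      by (cases e'') auto
    ultimately show thesis using that by blast
  qed
  have params: "params (Q r) = params (\<Pi> r)" "nonces (Q r) = nonces (\<Pi> r)"
    using Q r(2) by (auto simp: annotates_def)
  have wf: "distinct (params (\<Pi> r))" "length (params (\<Pi> r)) = k"
    using \<Pi> r(2) by (auto simp: is_protocol_def wf_role_def)
  have vs: "set (vs r) \<subseteq> set (nonces (\<Pi> r))" and "us = map AV (params (\<Pi> r)) @ map Var (vs r)"
    using args[OF r(2) us(1)] by blast+
  then have "us' = map AV (params (?P r)) @ map Var (vs r)"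
    using us(2) params by simp
  moreover have "map (inst nonce ?P \<alpha> \<sigma> r sid) (map AV (params (?P r))) = map (\<lambda>a. Atm (Agt a)) (\<alpha> sid)"
    using wf len params by (intro inst_params) simp_all
  moreover have "map (inst nonce ?P \<alpha> \<sigma> r sid) (map Var (vs r)) = map (\<lambda>y. Name (nonce y sid)) (vs r)"
    using vs params by (auto simp: inst_def)
  ultimately have "ts = map (\<lambda>a. Atm (Agt a)) (\<alpha> sid) @ map (\<lambda>y. Name (nonce y sid)) (vs r)"
    using us'(2) by simp
  with r vs show thesis by (rule that)
qed

text \<open>Shared by aliveness and weak agreement. The final end event belongs to the attacked
  session, so it survives the filter and remains last. The last conclusion runs backwards, from the
  reduced to the original trace, because it has to transport the absence of \<open>Start\<close>
  events.\<close>

lemma agreement_reduction: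
  fixes \<Pi> Q :: "('a, 'x, 'y, 'n, 'p) protocol"
  assumes \<Pi>: "is_protocol k \<Pi>" and Q: "annotates k \<Pi> Q"
    and fresh: "fresh_nonces Ne k (transform k z \<Pi>) nonce"
    and T0: "T0 \<subseteq> ground_atoms"
    and keys: "protocol_lgKeys k \<Pi> \<inter> protocol_plaintext k \<Pi> \<subseteq> T0 \<union> eps_keys \<epsilon>"
    and args: "\<forall>r\<in>{1..k}. \<forall>us. Status p us \<in> set (events (Q r)) \<longrightarrow> us = map AV (params (\<Pi> r))"
    and exec: "is_exec nonce k (transform k z Q) sc \<alpha> exec" and valid: "valid sg \<epsilon> Ne T0 exec"
    and as: "uncompromised sg \<epsilon> Ne T0 as"
    and last: "exec \<noteq> []" "fst (last exec) = Status p (map (\<lambda>a. Atm (Agt a)) as)"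
  obtains sc' exec' where "is_exec nonce k (transform k z Q) sc' \<alpha> exec'"
    and "valid sg \<epsilon> Ne T0 exec'" and "\<forall>sid\<in>snd ` set exec'. honest sg \<epsilon> Ne T0 \<alpha> sid"
    and "one_session_per_role sc'"
    and "exec' \<noteq> []" and "fst (last exec') = Status p (map (\<lambda>a. Atm (Agt a)) as)"
    and "\<And>q bs sid. set bs \<subseteq> set as \<Longrightarrow>
      (Status q (map (\<lambda>a. Atm (Agt a)) bs), sid) \<in> set exec' \<Longrightarrow>
      (Status q (map (\<lambda>a. Atm (Agt a)) bs), sid) \<in> set exec"
proof -
  obtain sid0 where last_eq: "last exec = (Status p (map (\<lambda>a. Atm (Agt a)) as), sid0)"
    using last(2) by (cases "last exec") simp
  then have e: "(Status p (map (\<lambda>a. Atm (Agt a)) as), sid0) \<in> set exec"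
    using last(1) last_in_set by metis
  obtain r where "map (\<lambda>a. Atm (Agt a)) as = (map (\<lambda>a. Atm (Agt a)) (\<alpha> sid0) :: ('a, 'x, 'y, 'n) msg list)"
    using status_args[OF \<Pi> Q exec e, where vs = "\<lambda>_. []"] args by force
  then have as_eq: "as = \<alpha> sid0"
    by (simp add: inj_map_eq_map inj_def)
  have "sid0 \<in> snd ` set exec" "honest sg \<epsilon> Ne T0 \<alpha> sid0"
    using e as as_eq by (force simp: honest_def)+
  then obtain exec' \<rho> S sc' where
    exec'_eq: "exec' = map (\<lambda>(e, sid). (map_event \<rho> id e, sid)) (filter (\<lambda>x. snd x \<in> S) exec)"
    and S: "sid0 \<in> S"
    and exec': "is_exec nonce k (transform k z Q) sc' \<alpha> exec'" "valid sg \<epsilon> Ne T0 exec'"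
      "\<forall>sid\<in>snd ` set exec'. honest sg \<epsilon> Ne T0 \<alpha> sid" "one_session_per_role sc'"
    and deduce: "\<And>t. deduce sg \<epsilon> Ne (T0 \<union> K exec) t \<Longrightarrow> deduce sg \<epsilon> Ne (T0 \<union> K exec') (\<rho> t)"
    and agt: "\<And>a. \<rho> (Atm (Agt a)) = Atm (Agt a)"
    and eq_agt: "\<And>a t. a \<noteq> \<epsilon> \<Longrightarrow> \<rho> t = Atm (Agt a) \<Longrightarrow> t = Atm (Agt a)"
    and name: "\<And>r y. (r, sid0) \<in> set sc \<Longrightarrow> y \<in> set (nonces (Q r)) \<Longrightarrow>
      \<rho> (Name (nonce y sid0)) = Name (nonce y sid0)"
    by (rule one_tag_reduction[OF \<Pi> Q fresh T0 keys exec valid]) (rule that; assumption)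
  let ?f = "filter (\<lambda>x. snd x \<in> S)"
  have "?f exec = ?f (butlast exec @ [last exec])" using last(1) by simp
  also have "\<dots> = ?f (butlast exec) @ [last exec]" using S last_eq by simp
  finally have "?f exec = ?f (butlast exec) @ [last exec]" .
  then have "exec' \<noteq> []" "fst (last exec') = Status p (map (\<lambda>a. Atm (Agt a)) as)"
    by (simp_all add: exec'_eq last_eq comp_def agt)
  moreover have "(Status q (map (\<lambda>a. Atm (Agt a)) bs), sid) \<in> set exec"
    if bs: "set bs \<subseteq> set as" and q: "(Status q (map (\<lambda>a. Atm (Agt a)) bs), sid) \<in> set exec'" for q bs sid
  proof -
    obtain e where e: "(e, sid) \<in> set exec" "map_event \<rho> id e = Status q (map (\<lambda>a. Atm (Agt a)) bs)"
      using q unfolding exec'_eq by auto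
    then obtain ts where ts: "e = Status q ts" "map \<rho> ts = map (\<lambda>a. Atm (Agt a)) bs"
      by (cases e) auto
    \<comment> \<open>None of these agents can result from a replacement, so the arguments were the
      same before purging.\<close>
    have "\<forall>b\<in>set bs. b \<noteq> \<epsilon>" using bs as eps_compromised[of sg \<epsilon> Ne T0] by auto
    with ts(2) have "ts = map (\<lambda>a. Atm (Agt a)) bs"
      by (induction bs arbitrary: ts) (auto simp: Cons_eq_map_conv map_eq_Cons_conv dest: eq_agt)
    with e ts show ?thesis by simp
  qed
  ultimately show thesis by (rule that[OF exec'])
qed

theorem corollary1:
  fixes sg :: bool
    and \<epsilon> :: "'a::infinite"
    and Ne :: "'n::infinite set"
    and nonce :: "'y::infinite \<Rightarrow> nat \<Rightarrow> 'n"
    and k :: nat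
    and \<Pi> :: "('a, 'x::infinite, 'y, 'n, 'p) protocol"
    and z :: "nat \<Rightarrow> nat \<Rightarrow> 'y"
    and T0 :: "('a, 'x, 'y, 'n) msg set"
    and xs :: "'x list"
    and y :: 'y
  assumes "infinite Ne"
    and "is_protocol k \<Pi>"
    and "protocol_preds k \<Pi> \<inter> ({Secret, Start, End} \<union> range EndRole) = {}"
    and "fresh_tag_vars k \<Pi> z"
    and "fresh_nonces Ne k (transform k z \<Pi>) nonce"
    and "T0 \<subseteq> ground_atoms"
    and "protocol_lgKeys k \<Pi> \<inter> protocol_plaintext k \<Pi> \<subseteq> T0 \<union> eps_keys \<epsilon>"
    and "length xs = k" and "distinct xs"
  shows
    "(\<forall>j\<in>{1..k}. \<forall>h\<in>{1..length (nonces (\<Pi> j))}.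
        (\<exists>sc \<alpha> exec'. attack_trace sg \<epsilon> Ne nonce T0 k (transform k z (annot_secrecy j h \<Pi>))
          (attack_secrecy xs y) sc \<alpha> exec') \<longrightarrow>
        (\<exists>sc \<alpha> exec. attack_trace sg \<epsilon> Ne nonce T0 k (transform k z (annot_secrecy j h \<Pi>))
          (attack_secrecy xs y) sc \<alpha> exec \<and>
          (\<forall>sid\<in>snd ` set exec. honest sg \<epsilon> Ne T0 \<alpha> sid) \<and> one_session_per_role sc)) \<and>
     (  (\<exists>sc \<alpha> exec'. attack_trace sg \<epsilon> Ne nonce T0 k (transform k z (annot_aliveness \<Pi>))
          (attack_aliveness xs) sc \<alpha> exec') \<longrightarrow>
        (\<exists>sc \<alpha> exec. attack_trace sg \<epsilon> Ne nonce T0 k (transform k z (annot_aliveness \<Pi>))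
          (attack_aliveness xs) sc \<alpha> exec \<and>
          (\<forall>sid\<in>snd ` set exec. honest sg \<epsilon> Ne T0 \<alpha> sid) \<and> one_session_per_role sc)) \<and>
     (\<forall>i\<in>{1..k}. \<forall>j\<in>{1..k}. i \<noteq> j \<longrightarrow>
        (\<exists>sc \<alpha> exec'. attack_trace sg \<epsilon> Ne nonce T0 k (transform k z (annot_weak_agreement \<Pi>))
          (attack_weak_agreement i j xs) sc \<alpha> exec') \<longrightarrow>
        (\<exists>sc \<alpha> exec. attack_trace sg \<epsilon> Ne nonce T0 k (transform k z (annot_weak_agreement \<Pi>))
          (attack_weak_agreement i j xs) sc \<alpha> exec \<and>
          (\<forall>sid\<in>snd ` set exec. honest sg \<epsilon> Ne T0 \<alpha> sid) \<and> one_session_per_role sc))"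
proof -
  \<comment> \<open>The annotation symbols do not occur in \<Pi>, so an event with such a symbol in
    an annotated role stems from the annotation, with known arguments.\<close>
  have preds: "p \<notin> preds_in e" if "r \<in> {1..k}" "e \<in> set (events (\<Pi> r))"
    "p \<in> {Secret, Start, End} \<union> range EndRole" for p r e
    using that assms(3) unfolding protocol_preds_def by blast
  have honest: "honest sg \<epsilon> Ne T0 \<alpha> sid \<longleftrightarrow> uncompromised sg \<epsilon> Ne T0 (\<alpha> sid)" for \<alpha> sid
    by (simp add: honest_def)
  have secrecy: "\<exists>sc \<alpha> exec. attack_trace sg \<epsilon> Ne nonce T0 k (transform k z (annot_secrecy j h \<Pi>))
          (attack_secrecy xs y) sc \<alpha> exec \<and>
          (\<forall>sid\<in>snd ` set exec. honest sg \<epsilon> Ne T0 \<alpha> sid) \<and> one_session_per_role sc"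
    if j: "j \<in> {1..k}" and h: "h \<in> {1..length (nonces (\<Pi> j))}"
      and attack: "attack_trace sg \<epsilon> Ne nonce T0 k (transform k z (annot_secrecy j h \<Pi>))
          (attack_secrecy xs y) sc \<alpha> exec" for j h sc \<alpha> exec
  proof -
    let ?Q = "annot_secrecy j h \<Pi>" and ?y = "nonces (\<Pi> j) ! (h - 1)"
    note Q = annotates_secrecy[of k \<Pi> j h]
    have exec: "is_exec nonce k (transform k z ?Q) sc \<alpha> exec" and valid: "valid sg \<epsilon> Ne T0 exec"
      and sat: "sat sg \<epsilon> Ne T0 exec (attack_secrecy xs y)"
      using attack by (auto simp: attack_trace_def)
    from sat obtain as t sid0 where as: "length as = length xs" "uncompromised sg \<epsilon> Ne T0 as"
      and e: "(Status Secret (map (\<lambda>a. Atm (Agt a)) as @ [t]), sid0) \<in> set exec"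
      and t: "deduce sg \<epsilon> Ne (T0 \<union> K exec) t"
      unfolding sat_attack_secrecy[OF assms(9)] by blast
    have y: "?y \<in> set (nonces (\<Pi> j))" using h by (intro nth_mem) auto
    have args: "us = map AV (params (\<Pi> r)) @ map Var (if r = j then [?y] else []) \<and>
        set (if r = j then [?y] else []) \<subseteq> set (nonces (\<Pi> r)) \<and> r = j"
      if "r \<in> {1..k}" "Status Secret us \<in> set (events (?Q r))" for r us
    proof -
      have "Status Secret us \<notin> set (events (\<Pi> r))"
        using preds[OF that(1), of "Status Secret us" Secret] by auto
      then show ?thesis
        using that(2) y by (cases "r = j") (simp_all add: annot_secrecy_def)
    qed
    obtain r where r: "(r, sid0) \<in> set sc" "r \<in> {1..k}"
      and ts: "map (\<lambda>a. Atm (Agt a)) as @ [t] = map (\<lambda>a. Atm (Agt a)) (\<alpha> sid0) @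
        map (\<lambda>y. Name (nonce y sid0)) (if r = j then [?y] else [])"
    proof (rule status_args[OF assms(2) Q exec e, where vs = "\<lambda>r. if r = j then [?y] else []"])
      show "us = map AV (params (\<Pi> r)) @ map Var (if r = j then [?y] else []) \<and>
          set (if r = j then [?y] else []) \<subseteq> set (nonces (\<Pi> r))"
        if "r \<in> {1..k}" "Status Secret us \<in> set (events (?Q r))" for r us
        using args[OF that] by blast
    qed
    have "length (\<alpha> sid0) = length as"
      using exec as(1) assms(8) by (simp add: is_exec_def)
    \<comment> \<open>The two lists can only have the same length if the extra nonce argument is
      present, which singles out role j.\<close>
    moreover from this arg_cong[OF ts, of length] have rj: "r = j"
      by (simp split: if_splits)
    ultimately have "map (\<lambda>a. Atm (Agt a)) as = (map (\<lambda>a. Atm (Agt a)) (\<alpha> sid0) :: ('a, 'x, 'y, 'n) msg list)"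
      and t_eq: "t = Name (nonce ?y sid0)"
      using ts by simp_all
    then have as_eq: "as = \<alpha> sid0"
      by (simp add: inj_map_eq_map inj_def)
    have "sid0 \<in> snd ` set exec" "honest sg \<epsilon> Ne T0 \<alpha> sid0"
      using e as(2) as_eq honest by force+
    then obtain exec' \<rho> S sc' where
      exec'_eq: "exec' = map (\<lambda>(e, sid). (map_event \<rho> id e, sid)) (filter (\<lambda>x. snd x \<in> S) exec)"
      and S: "sid0 \<in> S"
      and exec': "is_exec nonce k (transform k z ?Q) sc' \<alpha> exec'" "valid sg \<epsilon> Ne T0 exec'"
        "\<forall>sid\<in>snd ` set exec'. honest sg \<epsilon> Ne T0 \<alpha> sid" "one_session_per_role sc'"
      and deduce: "\<And>t. deduce sg \<epsilon> Ne (T0 \<union> K exec) t \<Longrightarrow> deduce sg \<epsilon> Ne (T0 \<union> K exec') (\<rho> t)"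
      and agt: "\<And>a. \<rho> (Atm (Agt a)) = Atm (Agt a)"
      and eq_agt: "\<And>a t. a \<noteq> \<epsilon> \<Longrightarrow> \<rho> t = Atm (Agt a) \<Longrightarrow> t = Atm (Agt a)"
      and name: "\<And>r y. (r, sid0) \<in> set sc \<Longrightarrow> y \<in> set (nonces (?Q r)) \<Longrightarrow>
        \<rho> (Name (nonce y sid0)) = Name (nonce y sid0)"
      by (rule one_tag_reduction[OF assms(2) Q assms(5,6,7) exec valid]) (rule that; assumption)
    \<comment> \<open>The secret is a nonce of the attacked session itself, so purging keeps it and
      its derivability carries over unchanged.\<close>
    have \<rho>t: "\<rho> t = t"
      unfolding t_eq using r(1) y by (intro name[of j]) (simp_all add: rj annot_secrecy_def)
    have "(map_event \<rho> id (Status Secret (map (\<lambda>a. Atm (Agt a)) as @ [t])), sid0) \<in> set exec'"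
      unfolding exec'_eq using e S by force
    then have "(Status Secret (map (\<lambda>a. Atm (Agt a)) as @ [t]), sid0) \<in> set exec'"
      by (simp add: comp_def agt \<rho>t)
    moreover have "deduce sg \<epsilon> Ne (T0 \<union> K exec') t" using deduce[OF t] \<rho>t by simp
    moreover have "ground t" by (simp add: t_eq ground_def)
    ultimately have "sat sg \<epsilon> Ne T0 exec' (attack_secrecy xs y)"
      unfolding sat_attack_secrecy[OF assms(9)] using as by blast
    with exec' show ?thesis unfolding attack_trace_def by blast
  qed
  have aliveness: "\<exists>sc \<alpha> exec. attack_trace sg \<epsilon> Ne nonce T0 k (transform k z (annot_aliveness \<Pi>))
          (attack_aliveness xs) sc \<alpha> exec \<and>
          (\<forall>sid\<in>snd ` set exec. honest sg \<epsilon> Ne T0 \<alpha> sid) \<and> one_session_per_role sc"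
    if attack: "attack_trace sg \<epsilon> Ne nonce T0 k (transform k z (annot_aliveness \<Pi>))
          (attack_aliveness xs) sc \<alpha> exec" for sc \<alpha> exec
  proof -
    let ?Q = "annot_aliveness \<Pi>"
    have exec: "is_exec nonce k (transform k z ?Q) sc \<alpha> exec" "valid sg \<epsilon> Ne T0 exec"
      and sat: "sat sg \<epsilon> Ne T0 exec (attack_aliveness xs)"
      using attack by (auto simp: attack_trace_def)
    from sat obtain as a where as: "length as = length xs" "uncompromised sg \<epsilon> Ne T0 as"
      and last: "exec \<noteq> []" "fst (last exec) = Status End (map (\<lambda>a. Atm (Agt a)) as)"
      and a: "a \<in> set as" "\<And>sid. (Status Start [Atm (Agt a)], sid) \<notin> set exec"
      unfolding sat_attack_aliveness[OF assms(9)] by blast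
    have args: "\<forall>r\<in>{1..k}. \<forall>us. Status End us \<in> set (events (?Q r)) \<longrightarrow> us = map AV (params (\<Pi> r))"
    proof (intro ballI allI impI)
      fix r us assume r: "r \<in> {1..k}" and us: "Status End us \<in> set (events (?Q r))"
      have "Status End us \<notin> set (events (\<Pi> r))"
        using preds[OF r, of "Status End us" "End"] by auto
      with us show "us = map AV (params (\<Pi> r))"
        by (auto simp: annot_aliveness_def)
    qed
    obtain sc' exec' where
      exec': "is_exec nonce k (transform k z ?Q) sc' \<alpha> exec'" "valid sg \<epsilon> Ne T0 exec'"
        "\<forall>sid\<in>snd ` set exec'. honest sg \<epsilon> Ne T0 \<alpha> sid" "one_session_per_role sc'"
      and last': "exec' \<noteq> []" "fst (last exec') = Status End (map (\<lambda>a. Atm (Agt a)) as)"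
      and old: "\<And>q bs sid. set bs \<subseteq> set as \<Longrightarrow>
        (Status q (map (\<lambda>a. Atm (Agt a)) bs), sid) \<in> set exec' \<Longrightarrow>
        (Status q (map (\<lambda>a. Atm (Agt a)) bs), sid) \<in> set exec"
      by (rule agreement_reduction[OF assms(2) annotates_aliveness[OF assms(2)] assms(5,6,7) args exec as(2) last])
        (rule that; assumption)
    have "(Status Start [Atm (Agt a)], sid) \<notin> set exec'" for sid
      using old[of "[a]" Start sid] a by auto
    then have "sat sg \<epsilon> Ne T0 exec' (attack_aliveness xs)"
      unfolding sat_attack_aliveness[OF assms(9)] using as last' a(1) by blast
    with exec' show ?thesis unfolding attack_trace_def by blast
  qed
  have weak_agreement: "\<exists>sc \<alpha> exec. attack_trace sg \<epsilon> Ne nonce T0 k (transform k z (annot_weak_agreement \<Pi>))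
          (attack_weak_agreement i j xs) sc \<alpha> exec \<and>
          (\<forall>sid\<in>snd ` set exec. honest sg \<epsilon> Ne T0 \<alpha> sid) \<and> one_session_per_role sc"
    if ij: "i \<in> {1..k}" "j \<in> {1..k}"
      and attack: "attack_trace sg \<epsilon> Ne nonce T0 k (transform k z (annot_weak_agreement \<Pi>))
          (attack_weak_agreement i j xs) sc \<alpha> exec" for i j sc \<alpha> exec
  proof -
    let ?Q = "annot_weak_agreement \<Pi>"
    have ij': "i \<in> {1..length xs}" "j \<in> {1..length xs}" using ij assms(8) by simp_all
    note sat_iff = sat_attack_weak_agreement[OF assms(9) ij']
    have exec: "is_exec nonce k (transform k z ?Q) sc \<alpha> exec" "valid sg \<epsilon> Ne T0 exec"
      and sat: "sat sg \<epsilon> Ne T0 exec (attack_weak_agreement i j xs)"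
      using attack by (auto simp: attack_trace_def)
    from sat obtain as where as: "length as = length xs" "uncompromised sg \<epsilon> Ne T0 as"
      and last: "exec \<noteq> []" "fst (last exec) = Status (EndRole j) (map (\<lambda>a. Atm (Agt a)) as)"
      and start: "\<And>sid. (Status Start [Atm (Agt (as ! (i - 1))), Atm (Agt (as ! (j - 1)))], sid) \<notin> set exec"
      unfolding sat_iff by blast
    have args: "\<forall>r\<in>{1..k}. \<forall>us. Status (EndRole j) us \<in> set (events (?Q r)) \<longrightarrow> us = map AV (params (\<Pi> r))"
    proof (intro ballI allI impI)
      fix r us assume r: "r \<in> {1..k}" and us: "Status (EndRole j) us \<in> set (events (?Q r))"
      have "Status (EndRole j) us \<notin> set (events (\<Pi> r))"
        using preds[OF r, of "Status (EndRole j) us" "EndRole j"] by auto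
      with us show "us = map AV (params (\<Pi> r))"
        by (auto simp: annot_weak_agreement_def)
    qed
    obtain sc' exec' where
      exec': "is_exec nonce k (transform k z ?Q) sc' \<alpha> exec'" "valid sg \<epsilon> Ne T0 exec'"
        "\<forall>sid\<in>snd ` set exec'. honest sg \<epsilon> Ne T0 \<alpha> sid" "one_session_per_role sc'"
      and last': "exec' \<noteq> []" "fst (last exec') = Status (EndRole j) (map (\<lambda>a. Atm (Agt a)) as)"
      and old: "\<And>q bs sid. set bs \<subseteq> set as \<Longrightarrow>
        (Status q (map (\<lambda>a. Atm (Agt a)) bs), sid) \<in> set exec' \<Longrightarrow>
        (Status q (map (\<lambda>a. Atm (Agt a)) bs), sid) \<in> set exec"
      by (rule agreement_reduction[OF assms(2) annotates_weak_agreement[OF assms(2)] assms(5,6,7) args exec as(2) last])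
        (rule that; assumption)
    have "as ! (i - 1) \<in> set as" "as ! (j - 1) \<in> set as"
      using ij' as(1) by (auto intro!: nth_mem)
    then have "(Status Start [Atm (Agt (as ! (i - 1))), Atm (Agt (as ! (j - 1)))], sid) \<notin> set exec'" for sid
      using old[of "[as ! (i - 1), as ! (j - 1)]" Start sid] start by auto
    then have "sat sg \<epsilon> Ne T0 exec' (attack_weak_agreement i j xs)"
      unfolding sat_iff using as last' by blast
    with exec' show ?thesis unfolding attack_trace_def by blast
  qed
  show ?thesis
    by (intro conjI ballI impI; elim exE; rule secrecy aliveness weak_agreement; assumption)
qed

end
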